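(* Let $\mathcal A$ be an arbitrary set of indices, $X=c_0(\mathcal A)$, and let $Y$ be a Banach space. Let $\omega:(0,\infty)\to(0,\infty)$ be a non-decreasing function such that $\lim_{t\to 0}\omega(t)=0$, $\lim_{t\to\infty}\omega(t)=\infty$, $\lim_{t\to 0}t/\omega(t)=0$, and, for some constant $C_{\mathrm{db}}>1$, $\omega(2t)\le C_{\mathrm{db}}\,\omega(t)$ for all $t\in(0,\infty)$. Then: (i) $\overline{C^\infty(X,Y)\cap\dot{\mathrm{VC}}^{0,\omega}_{\mathrm{small}}(X,Y)}^{\,\dot C^{0,\omega}(X,Y)}=\dot{\mathrm{VC}}^{0,\omega}_{\mathrm{small}}(X,Y)$; (ii) $\overline{C^\infty_{\mathrm{bs}}(X,Y)\cap\dot{\mathrm{VC}}^{0,\omega}(X,Y)}^{\,\dot C^{0,\omega}(X,Y)}=\dot{\mathrm{VC}}^{0,\omega}(X,Y)$.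
   Context: $c_0(\mathcal A)$ is the Banach space of $x=(x_\alpha)_{\alpha\in\mathcal A}\in\mathbb R^{\mathcal A}$ such that for every $\varepsilon>0$ there is a finite $S\subset\mathcal A$ with $|x_\alpha|\le\varepsilon$ for all $\alpha\in\mathcal A\setminus S$, with norm $\|x\|_\infty=\sup_\alpha|x_\alpha|$. For normed spaces $X,Y$, $\dot C^{0,\omega}(X,Y)$ is the set of $f:X\to Y$ with $\|f\|_{\dot C^{0,\omega}(X,Y)}:=\sup_{x\ne y}\frac{\|f(x)-f(y)\|_Y}{\omega(\|x-y\|_X)}<\infty$. For $x\neq y$ put $\mathrm{osc}^\omega_{(x,y)}(f)=\frac{\|f(x)-f(y)\|_Y}{\omega(\|x-y\|_X)}$, and for $\delta>0$ put $\mathrm{osc}^\omega_\delta(f)=\sup\{\mathrm{osc}^\omega_{(x,y)}(f): x,y\in X,\ \|x-y\|_X=\delta\}$. Define $\dot{\mathrm{VC}}^{0,\omega}_{\mathrm{small}}(X,Y)=\{f\in\dot C^{0,\omega}(X,Y):\lim_{\delta\to0}\mathrm{osc}^\omega_\delta(f)=0\}$, $\dot{\mathrm{VC}}^{0,\omega}_{\mathrm{large}}(X,Y)=\{f\in\dot C^{0,\omega}(X,Y):\lim_{\delta\to\infty}\mathrm{osc}^\omega_\delta(f)=0\}$, $\dot{\mathrm{VC}}^{0,\omega}_{\mathrm{far}}(X,Y)=\{f\in\dot C^{0,\omega}(X,Y):\lim_{\delta\to\infty}\sup_{x\ne y,\ \min(\|x\|,\|y\|)>\delta}\mathrm{osc}^\omega_{(x,y)}(f)=0\}$,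 and $\dot{\mathrm{VC}}^{0,\omega}(X,Y)$ as the intersection of these three sets. $C^\infty(X,Y)$ denotes maps with continuous Fréchet derivatives of all orders; $C^\infty_{\mathrm{bs}}(X,Y)$ the subset of those with bounded support (vanishing outside some ball $B(0,R)$). For $\mathcal C\subset\dot C^{0,\omega}(X,Y)$, $\overline{\mathcal C}^{\,\dot C^{0,\omega}(X,Y)}$ is the set of $f\in\dot C^{0,\omega}(X,Y)$ for which there is a sequence $(f_n)\subset\mathcal C$ with $\|f_n-f\|_{\dot C^{0,\omega}(X,Y)}\to0$. *)

theory Defs
  imports "HOL-Analysis.Analysis"
begin

section \<open>The space of null families\<close>

text \<open>
  An index set is an arbitrary set A of elements of a type 'i (possibly empty). The type
  'i czero consists of the null families over all of 'i; the space of null families over A is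
  its closed subspace \<open>c0 A\<close> of families vanishing outside A, extension by zero being a linear
  isometry.
\<close>

definition null_family :: "('i \<Rightarrow> real) \<Rightarrow> bool" where
  "null_family x \<longleftrightarrow> (\<forall>\<epsilon>>0. \<exists>S. finite S \<and> (\<forall>i. i \<notin> S \<longrightarrow> \<bar>x i\<bar> \<le> \<epsilon>))"

lemma null_family_zero: "null_family (\<lambda>_. 0)"
  unfolding null_family_def by auto

lemma null_family_scale:
  assumes "null_family x" shows "null_family (\<lambda>i. a * x i)"
  unfolding null_family_def
proof (intro allI impI)
  fix e :: real assume "e > 0"
  then have "e / (\<bar>a\<bar> + 1) > 0" by simp
  with assms obtain S where S: "finite S" "\<And>i. i \<notin> S \<Longrightarrow> \<bar>x i\<bar> \<le> e / (\<bar>a\<bar> + 1)"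
    unfolding null_family_def by blast
  have "\<bar>a * x i\<bar> \<le> e" if "i \<notin> S" for i
  proof -
    have "\<bar>a * x i\<bar> \<le> (\<bar>a\<bar> + 1) * \<bar>x i\<bar>" by (simp add: abs_mult distrib_right)
    also have "\<dots> \<le> (\<bar>a\<bar> + 1) * (e / (\<bar>a\<bar> + 1))"
      using S(2)[OF that] by (intro mult_left_mono) auto
    finally show ?thesis by simp
  qed
  with S show "\<exists>S. finite S \<and> (\<forall>i. i \<notin> S \<longrightarrow> \<bar>a * x i\<bar> \<le> e)" by blast
qed

lemma null_family_add:
  assumes "null_family x" "null_family y" shows "null_family (\<lambda>i. x i + y i)"
  unfolding null_family_def
proof (intro allI impI)
  fix e :: real assume "e > 0"
  then have "e / 2 > 0" by simp
  obtain S where S: "finite S" "\<And>i. i \<notin> S \<Longrightarrow> \<bar>x i\<bar> \<le> e / 2"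
    using assms(1) \<open>e / 2 > 0\<close> unfolding null_family_def by blast
  obtain T where T: "finite T" "\<And>i. i \<notin> T \<Longrightarrow> \<bar>y i\<bar> \<le> e / 2"
    using assms(2) \<open>e / 2 > 0\<close> unfolding null_family_def by blast
  have "\<bar>x i + y i\<bar> \<le> e" if "i \<notin> S \<union> T" for i
    using S(2)[of i] T(2)[of i] that by auto
  moreover have "finite (S \<union> T)" using S T by simp
  ultimately show "\<exists>S. finite S \<and> (\<forall>i. i \<notin> S \<longrightarrow> \<bar>x i + y i\<bar> \<le> e)" by blast
qed

lemma null_family_bdd:
  assumes "null_family x" shows "bdd_above (range (\<lambda>i. \<bar>x i\<bar>))"
proof -
  obtain S where S: "finite S" "\<And>i. i \<notin> S \<Longrightarrow> \<bar>x i\<bar> \<le> 1"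
    using assms unfolding null_family_def by (meson zero_less_one)
  have "range (\<lambda>i. \<bar>x i\<bar>) \<subseteq> (\<lambda>i. \<bar>x i\<bar>) ` S \<union> {..1}" using S(2) by auto
  moreover have "bdd_above ((\<lambda>i. \<bar>x i\<bar>) ` S \<union> {..1})" using S(1) by simp
  ultimately show ?thesis by (rule bdd_above_mono[rotated])
qed

typedef 'i czero = "{x :: 'i \<Rightarrow> real. null_family x}"
  morphisms coord Abs_czero
  using null_family_zero by blast

lemma null_family_coord: "null_family (coord x)"
  using coord by blast

lemma coord_Abs: "null_family x \<Longrightarrow> coord (Abs_czero x) = x"
  by (simp add: Abs_czero_inverse)

lemma czero_eqI: "(\<And>i. coord x i = coord y i) \<Longrightarrow> x = y"
  by (simp add: coord_inject[symmetric] ext)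

instantiation czero :: (type) real_vector
begin

definition zero_czero :: "'a czero" where "0 = Abs_czero (\<lambda>_. 0)"
definition plus_czero :: "'a czero \<Rightarrow> 'a czero \<Rightarrow> 'a czero"
  where "x + y = Abs_czero (\<lambda>i. coord x i + coord y i)"
definition scaleR_czero :: "real \<Rightarrow> 'a czero \<Rightarrow> 'a czero"
  where "a *\<^sub>R x = Abs_czero (\<lambda>i. a * coord x i)"
definition uminus_czero :: "'a czero \<Rightarrow> 'a czero" where "- x = (-1) *\<^sub>R (x :: 'a czero)"
definition minus_czero :: "'a czero \<Rightarrow> 'a czero \<Rightarrow> 'a czero" where "x - y = x + - (y :: 'a czero)"

lemma coord_zero: "coord 0 i = 0"
  by (simp add: zero_czero_def coord_Abs null_family_zero)

lemma coord_add: "coord (x + y) i = coord x i + coord y i"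
  by (simp add: plus_czero_def coord_Abs null_family_add null_family_coord)

lemma coord_scaleR: "coord (a *\<^sub>R x) i = a * coord x i"
  by (simp add: scaleR_czero_def coord_Abs null_family_scale null_family_coord)

lemma coord_uminus: "coord (- x) i = - coord x i"
  by (simp add: uminus_czero_def coord_scaleR)

lemma coord_diff: "coord (x - y) i = coord x i - coord y i"
  by (simp add: minus_czero_def coord_add coord_uminus)

instance
  by standard
    (rule czero_eqI;
      simp add: coord_zero coord_add coord_scaleR coord_uminus coord_diff algebra_simps)+

end

instantiation czero :: (type) real_normed_vector
begin

definition norm_czero :: "'a czero \<Rightarrow> real" where "norm x = (SUP i. \<bar>coord x i\<bar>)"
definition sgn_czero :: "'a czero \<Rightarrow> 'a czero" where "sgn x = x /\<^sub>R norm (x :: 'a czero)"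
definition dist_czero :: "'a czero \<Rightarrow> 'a czero \<Rightarrow> real" where "dist x y = norm (x - y :: 'a czero)"
definition uniformity_czero :: "('a czero \<times> 'a czero) filter"
  where "uniformity = (INF e\<in>{0<..}. principal {(x, y). dist x (y :: 'a czero) < e})"
definition open_czero :: "'a czero set \<Rightarrow> bool"
  where "open U \<longleftrightarrow> (\<forall>x\<in>U. eventually (\<lambda>(x', y). x' = x \<longrightarrow> (y :: 'a czero) \<in> U) uniformity)"

lemma coord_le_norm: "\<bar>coord x i\<bar> \<le> norm x"
  unfolding norm_czero_def by (rule cSUP_upper[OF UNIV_I null_family_bdd[OF null_family_coord]])

lemma norm_czero_le: "(\<And>i. \<bar>coord x i\<bar> \<le> b) \<Longrightarrow> norm x \<le> b"
  unfolding norm_czero_def by (rule cSUP_least) auto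

instance
proof
  fix x y :: "'a czero" and a :: real and U :: "'a czero set"
  show "dist x y = norm (x - y)" by (rule dist_czero_def)
  show "sgn x = x /\<^sub>R norm x" by (rule sgn_czero_def)
  show "uniformity = (INF e\<in>{0<..}. principal {(x, y :: 'a czero). dist x y < e})"
    by (rule uniformity_czero_def)
  show "open U \<longleftrightarrow> (\<forall>x\<in>U. \<forall>\<^sub>F (x', y) in uniformity. x' = x \<longrightarrow> y \<in> U)"
    by (rule open_czero_def)
  have nonneg: "0 \<le> norm z" for z :: "'a czero"
    using coord_le_norm[of z undefined] by linarith
  show "norm x = 0 \<longleftrightarrow> x = 0"
  proof
    assume "norm x = 0"
    then show "x = 0"
      by (metis abs_le_zero_iff coord_le_norm coord_zero czero_eqI)
  next
    assume "x = 0"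
    then have "norm x \<le> 0" by (intro norm_czero_le) (simp add: coord_zero)
    then show "norm x = 0" using nonneg[of x] by simp
  qed
  show "norm (x + y) \<le> norm x + norm y"
  proof (rule norm_czero_le)
    fix i
    show "\<bar>coord (x + y) i\<bar> \<le> norm x + norm y"
      using coord_le_norm[of x i] coord_le_norm[of y i] unfolding coord_add by linarith
  qed
  have scale_le: "norm (b *\<^sub>R z) \<le> \<bar>b\<bar> * norm z" for b :: real and z :: "'a czero"
    by (rule norm_czero_le) (simp add: coord_scaleR abs_mult coord_le_norm mult_left_mono)
  show "norm (a *\<^sub>R x) = \<bar>a\<bar> * norm x"
  proof (rule antisym[OF scale_le])
    show "\<bar>a\<bar> * norm x \<le> norm (a *\<^sub>R x)"
    proof (cases "a = 0")
      case True
      then show ?thesis using nonneg by simp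
    next
      case False
      then have "norm x \<le> \<bar>inverse a\<bar> * norm (a *\<^sub>R x)"
        using scale_le[of "inverse a" "a *\<^sub>R x"] by simp
      then show ?thesis using False by (simp add: field_simps)
    qed
  qed
qed

end

definition c0 :: "'i set \<Rightarrow> 'i czero set" where
  "c0 A = {x. \<forall>i. i \<notin> A \<longrightarrow> coord x i = 0}"

lemma subspace_c0: "subspace (c0 A)"
  by (rule subspaceI) (auto simp: c0_def coord_zero coord_add coord_scaleR)

lemma norm_c0:
  assumes "x \<in> c0 A" "A \<noteq> {}" shows "norm x = (SUP i\<in>A. \<bar>coord x i\<bar>)"
proof (rule antisym)
  have bdd: "bdd_above ((\<lambda>i. \<bar>coord x i\<bar>) ` A)"
    by (rule bdd_above_mono[OF null_family_bdd[OF null_family_coord[of x]]]) auto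
  obtain j where "j \<in> A" using assms(2) by blast
  have sup: "\<bar>coord x i\<bar> \<le> (SUP i\<in>A. \<bar>coord x i\<bar>)" if "i \<in> A" for i
    by (rule cSUP_upper[OF that bdd])
  show "norm x \<le> (SUP i\<in>A. \<bar>coord x i\<bar>)"
  proof (rule norm_czero_le)
    fix i
    show "\<bar>coord x i\<bar> \<le> (SUP i\<in>A. \<bar>coord x i\<bar>)"
    proof (cases "i \<in> A")
      case False
      then have "coord x i = 0" using assms(1) by (simp add: c0_def)
      then show ?thesis using sup[OF \<open>j \<in> A\<close>] by simp
    qed (rule sup)
  qed
  show "(SUP i\<in>A. \<bar>coord x i\<bar>) \<le> norm x"
    by (rule cSUP_least[OF assms(2)]) (rule coord_le_norm)
qed

section \<open>Generalised Hoelder spaces and vanishing subspaces\<close>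

text \<open>
  In the following, X is a linear subspace of a normed space, regarded as a normed space in its own
  right. A map from X to the normed space 'b is a total function of which only the values on X
  matter. All seminorms are suprema in the extended nonnegative reals, so that a supremum over the
  empty set is 0 and an unbounded one is infinite.
\<close>

definition osc_pair :: "(real \<Rightarrow> real) \<Rightarrow> ('a::real_normed_vector \<Rightarrow> 'b::real_normed_vector)
    \<Rightarrow> 'a \<Rightarrow> 'a \<Rightarrow> ennreal" where
  "osc_pair \<omega> f x y = ennreal (norm (f x - f y) / \<omega> (norm (x - y)))"

definition holder_norm :: "(real \<Rightarrow> real) \<Rightarrow> 'a::real_normed_vector set
    \<Rightarrow> ('a \<Rightarrow> 'b::real_normed_vector) \<Rightarrow> ennreal" where
  "holder_norm \<omega> X f = (SUP (x, y)\<in>{(x, y). x \<in> X \<and> y \<in> X \<and> x \<noteq> y}. osc_pair \<omega> f x y)"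

definition osc_scale :: "(real \<Rightarrow> real) \<Rightarrow> 'a::real_normed_vector set
    \<Rightarrow> ('a \<Rightarrow> 'b::real_normed_vector) \<Rightarrow> real \<Rightarrow> ennreal" where
  "osc_scale \<omega> X f \<delta> =
     (SUP (x, y)\<in>{(x, y). x \<in> X \<and> y \<in> X \<and> norm (x - y) = \<delta>}. osc_pair \<omega> f x y)"

definition osc_far :: "(real \<Rightarrow> real) \<Rightarrow> 'a::real_normed_vector set
    \<Rightarrow> ('a \<Rightarrow> 'b::real_normed_vector) \<Rightarrow> real \<Rightarrow> ennreal" where
  "osc_far \<omega> X f \<delta> =
     (SUP (x, y)\<in>{(x, y). x \<in> X \<and> y \<in> X \<and> x \<noteq> y \<and> min (norm x) (norm y) > \<delta>}. osc_pair \<omega> f x y)"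

definition holder_space :: "(real \<Rightarrow> real) \<Rightarrow> 'a::real_normed_vector set
    \<Rightarrow> ('a \<Rightarrow> 'b::real_normed_vector) set" where
  "holder_space \<omega> X = {f. holder_norm \<omega> X f < \<infinity>}"

definition VC_small :: "(real \<Rightarrow> real) \<Rightarrow> 'a::real_normed_vector set
    \<Rightarrow> ('a \<Rightarrow> 'b::real_normed_vector) set" where
  "VC_small \<omega> X = {f \<in> holder_space \<omega> X. (osc_scale \<omega> X f \<longlongrightarrow> 0) (at_right 0)}"

definition VC_large :: "(real \<Rightarrow> real) \<Rightarrow> 'a::real_normed_vector set
    \<Rightarrow> ('a \<Rightarrow> 'b::real_normed_vector) set" where
  "VC_large \<omega> X = {f \<in> holder_space \<omega> X. (osc_scale \<omega> X f \<longlongrightarrow> 0) at_top}"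

definition VC_far :: "(real \<Rightarrow> real) \<Rightarrow> 'a::real_normed_vector set
    \<Rightarrow> ('a \<Rightarrow> 'b::real_normed_vector) set" where
  "VC_far \<omega> X = {f \<in> holder_space \<omega> X. (osc_far \<omega> X f \<longlongrightarrow> 0) at_top}"

definition VC :: "(real \<Rightarrow> real) \<Rightarrow> 'a::real_normed_vector set
    \<Rightarrow> ('a \<Rightarrow> 'b::real_normed_vector) set" where
  "VC \<omega> X = VC_small \<omega> X \<inter> VC_large \<omega> X \<inter> VC_far \<omega> X"

definition holder_closure :: "(real \<Rightarrow> real) \<Rightarrow> 'a::real_normed_vector set
    \<Rightarrow> ('a \<Rightarrow> 'b::real_normed_vector) set \<Rightarrow> ('a \<Rightarrow> 'b) set" where
  "holder_closure \<omega> X C = {f \<in> holder_space \<omega> X.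
     \<exists>F :: nat \<Rightarrow> 'a \<Rightarrow> 'b. (\<forall>n. F n \<in> C) \<and>
       (\<lambda>n. holder_norm \<omega> X (\<lambda>x. F n x - f x)) \<longlonglongrightarrow> 0}"

section \<open>Smooth maps\<close>

text \<open>
  The k-th Frechet derivative of a map at a point is an element of L(X, L(X, ..., L(X, Y))), which
  is identified in the usual isometric way with the space of bounded k-linear maps under the
  operator norm. The k arguments are passed as a list of length k whose head is the direction of
  the derivative taken last. In \<open>bounded_multilinear_on\<close> the entry 0 merely marks the slot in which
  linearity is tested.
\<close>

definition tuples :: "nat \<Rightarrow> 'a set \<Rightarrow> 'a list set" where
  "tuples k X = {vs. length vs = k \<and> set vs \<subseteq> X}"

definition bounded_multilinear_on :: "nat \<Rightarrow> 'a::real_normed_vector set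
    \<Rightarrow> ('a list \<Rightarrow> 'b::real_normed_vector) \<Rightarrow> bool" where
  "bounded_multilinear_on k X m \<longleftrightarrow>
     (\<forall>us vs. us @ 0 # vs \<in> tuples k X \<longrightarrow>
       (\<forall>v\<in>X. \<forall>w\<in>X. \<forall>a b.
         m (us @ (a *\<^sub>R v + b *\<^sub>R w) # vs) = a *\<^sub>R m (us @ v # vs) + b *\<^sub>R m (us @ w # vs))) \<and>
     (\<exists>K. \<forall>vs\<in>tuples k X. norm (m vs) \<le> K * prod_list (map norm vs))"

definition multilinear_norm :: "nat \<Rightarrow> 'a::real_normed_vector set
    \<Rightarrow> ('a list \<Rightarrow> 'b::real_normed_vector) \<Rightarrow> real" where
  "multilinear_norm k X m = (SUP vs\<in>tuples k (X \<inter> cball 0 1). norm (m vs))"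

definition frechet_derivatives :: "'a::real_normed_vector set \<Rightarrow> ('a \<Rightarrow> 'b::real_normed_vector)
    \<Rightarrow> (nat \<Rightarrow> 'a \<Rightarrow> 'a list \<Rightarrow> 'b) \<Rightarrow> bool" where
  "frechet_derivatives X f D \<longleftrightarrow>
     (\<forall>x\<in>X. D 0 x [] = f x) \<and>
     (\<forall>k. \<forall>x\<in>X. bounded_multilinear_on k X (D k x)) \<and>
     (\<forall>k. \<forall>x\<in>X.
       ((\<lambda>y. multilinear_norm k X (\<lambda>vs. D k y vs - D k x vs - D (Suc k) x ((y - x) # vs))
              / norm (y - x)) \<longlongrightarrow> 0) (at x within X))"

definition C_inf :: "'a::real_normed_vector set \<Rightarrow> ('a \<Rightarrow> 'b::real_normed_vector) set" where
  "C_inf X = {f. \<exists>D. frechet_derivatives X f D \<and>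
     (\<forall>k. \<forall>x\<in>X. ((\<lambda>y. multilinear_norm k X (\<lambda>vs. D k y vs - D k x vs)) \<longlongrightarrow> 0) (at x within X))}"

definition C_inf_bs :: "'a::real_normed_vector set \<Rightarrow> ('a \<Rightarrow> 'b::real_normed_vector) set" where
  "C_inf_bs X = {f \<in> C_inf X. \<exists>R>0. \<forall>x\<in>X. x \<notin> ball 0 R \<longrightarrow> f x = 0}"

end

(*
Idea. To smooth f at scale eta, compose it with the coordinatewise soft threshold at level
2 * eta and convolve the result, in every coordinate, with a smooth kernel of width eta. Near
a point x of c_0 all but finitely many coordinates are so small that the threshold
annihilates them wherever the kernel looks, so only a finite-dimensional convolution remains and
the result is smooth. Thresholding is 1-Lipschitz and convolution averages translates; hence
every modulus of continuity of f is inherited, and f moves by at most its oscillation at scale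
3 * eta. If f has vanishing small-scale oscillation, this is a small perturbation in the
Hoelder seminorm.

For bounded supports, f is first composed with a radial map which is the identity on
a huge ball and then slowly contracts the space to the origin. Pairs at small or large distance
are controlled by the vanishing of f at small and large scales; for intermediate distances either
both images are far away or the radial map contracts the pair to a small distance.
*)
theory Submission
  imports Defs
begin

section \<open>A smooth kernel\<close>

text \<open>There is no Lebesgue measure in infinite dimensions, so the coordinates used for
  averaging have to depend on the point. The gap between the two scales makes the local choices fit
  together: a coordinate of modulus at most \<eta> / 2, shifted by at most \<eta>, stays below the
  threshold 2 * \<eta>. The integrand is then constant in that coordinate; a kernel of mass 1
  reproduces it, and derivatives of the kernel integrate to 0. Adding such coordinates therefore
  changes neither the value nor any derivative at the point. The supremum norm makes the estimates
  independent of the number of coordinates: shifts in different coordinates do not add up. Bounds on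
  derivatives do depend on that number, but they are wanted only locally. The support is cut off by
  composition rather than by multiplication because then only differences of values of f occur, and
  f itself may be unbounded. The radial map has Lipschitz constant 3, and doubling bounds
  \<omega>(3t) by a multiple of \<omega>(t).\<close>

definition inv_exp :: "nat \<Rightarrow> real \<Rightarrow> real" where
  "inv_exp n x = (if x > 0 then inverse x ^ n * exp (- inverse x) else 0)"

text \<open>The functions \<open>inv_exp n\<close> span a space closed under differentiation, which
  gives all derivatives of exp (- 1/x) without computing their polynomial factors. At 0 the right
  difference quotient is the function of index \<open>n + 1\<close>, which tends to 0 because the
  exponential beats every power; the left one is 0.\<close>

lemma has_real_derivative_inv_exp:
  "(inv_exp n has_real_derivative inv_exp (n + 2) x - real n * inv_exp (n + 1) x) (at x)"
proof (cases "x = 0")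
  case False
  show ?thesis
  proof (cases "x > 0")
    case True
    \<comment> \<open>Truncated subtraction in \<open>n - 1\<close> is harmless: for
      \<open>n = 0\<close> the factor \<open>real n\<close> is 0.\<close>
    have pow: "real n * inverse x ^ (n - 1) * inverse x ^ 2 = real n * inverse x ^ (n + 1)"
      by (cases n) (auto simp: power2_eq_square)
    have "((\<lambda>x. inverse x ^ n * exp (- inverse x)) has_real_derivative
        inverse x ^ n * (inverse x ^ 2 * exp (- inverse x))
          - (real n * inverse x ^ (n - 1) * inverse x ^ 2) * exp (- inverse x)) (at x)"
      using True by (auto intro!: derivative_eq_intros simp: algebra_simps power2_eq_square)
    then have "((\<lambda>x. inverse x ^ n * exp (- inverse x)) has_real_derivative
        inv_exp (n + 2) x - real n * inv_exp (n + 1) x) (at x)"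
      unfolding pow using True by (simp add: inv_exp_def algebra_simps power_add power2_eq_square)
    moreover have "\<forall>\<^sub>F y in nhds x. inv_exp n y = inverse y ^ n * exp (- inverse y)"
      using True by (intro eventually_mono[OF eventually_nhds_in_open[of "{0<..}" x]])
        (auto simp: inv_exp_def)
    ultimately show ?thesis
      by (subst DERIV_cong_ev[where g = "\<lambda>x. inverse x ^ n * exp (- inverse x)", OF refl _ refl]) auto
  next
    case 2: False
    with False have "x < 0" by simp
    have "((\<lambda>x. 0) has_real_derivative
        inv_exp (n + 2) x - real n * inv_exp (n + 1) x) (at x)"
      using \<open>x < 0\<close> by (auto simp: inv_exp_def)
    moreover have "\<forall>\<^sub>F y in nhds x. inv_exp n y = 0"
      using \<open>x < 0\<close> by (intro eventually_mono[OF eventually_nhds_in_open[of "{..<0}" x]]) (auto simp: inv_exp_def)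
    ultimately show ?thesis
      by (subst DERIV_cong_ev[where g = "\<lambda>x. 0", OF refl _ refl]) auto
  qed
next
  case True
  have "((\<lambda>h::real. inverse h ^ Suc n * exp (- inverse h)) \<longlongrightarrow> 0) (at_right 0)"
  proof (rule filterlim_compose[OF _ filterlim_inverse_at_top_right])
    show "((\<lambda>t::real. t ^ Suc n * exp (- t)) \<longlongrightarrow> 0) at_top"
      using tendsto_power_div_exp_0[of "Suc n"] by (simp add: exp_minus divide_inverse)
  qed
  then have r: "((\<lambda>h. inv_exp n h / h) \<longlongrightarrow> 0) (at_right 0)"
  proof (rule Lim_transform_eventually)
    show "\<forall>\<^sub>F h in at_right 0. inverse h ^ Suc n * exp (- inverse h) = inv_exp n h / h"
      by (rule eventually_mono[OF eventually_at_right_less]) (simp add: inv_exp_def field_simps)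
  qed
  have l: "((\<lambda>h. inv_exp n h / h) \<longlongrightarrow> 0) (at_left 0)"
  proof (rule Lim_transform_eventually[OF tendsto_const])
    show "\<forall>\<^sub>F h in at_left 0. 0 = inv_exp n h / h"
      by (rule eventually_mono[OF eventually_at_left_real[of "-1"]]) (auto simp: inv_exp_def)
  qed
  have "((\<lambda>h. inv_exp n h / h) \<longlongrightarrow> 0) (at 0)"
    using l r filterlim_split_at by blast
  then show ?thesis using True by (simp add: DERIV_def inv_exp_def)
qed

text \<open>The recursion differentiates once and then takes \<open>j\<close> derivatives of the
  result, so inductions on \<open>j\<close> must keep \<open>n\<close> arbitrary.\<close>

primrec inv_exp_deriv :: "nat \<Rightarrow> nat \<Rightarrow> real \<Rightarrow> real" where
  "inv_exp_deriv 0 n x = inv_exp n x"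
| "inv_exp_deriv (Suc j) n x = inv_exp_deriv j (n + 2) x - real n * inv_exp_deriv j (n + 1) x"

lemma has_real_derivative_inv_exp_deriv:
  "(inv_exp_deriv j n has_real_derivative inv_exp_deriv (Suc j) n x) (at x)"
proof (induction j arbitrary: n)
  case 0
  then show ?case using has_real_derivative_inv_exp[of n x] by simp
next
  case (Suc j)
  show ?case unfolding inv_exp_deriv.simps(2)[of j n, abs_def]
    by (auto intro!: derivative_eq_intros Suc simp del: inv_exp_deriv.simps(2))
       (simp add: inv_exp_deriv.simps(2))
qed

lemma inv_exp_deriv_nonpos: "x \<le> 0 \<Longrightarrow> inv_exp_deriv j n x = 0"
  by (induction j arbitrary: n) (auto simp: inv_exp_def)

text \<open>
  With u = exp (- 1/x) on the positive half-line, \<open>bump_deriv \<eta> m j l\<close> is the m-th derivative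
  of the product of the j-th derivative of u at \<open>\<eta> + t\<close> and its l-th derivative at
  \<open>\<eta> - t\<close>; carrying j and l along replaces the Leibniz formula by a recursion.
\<close>

primrec bump_deriv :: "real \<Rightarrow> nat \<Rightarrow> nat \<Rightarrow> nat \<Rightarrow> real \<Rightarrow> real" where
  "bump_deriv \<eta> 0 j l t = inv_exp_deriv j 0 (\<eta> + t) * inv_exp_deriv l 0 (\<eta> - t)"
| "bump_deriv \<eta> (Suc m) j l t = bump_deriv \<eta> m (Suc j) l t - bump_deriv \<eta> m j (Suc l) t"

lemma has_real_derivative_bump_deriv:
  "(bump_deriv \<eta> m j l has_real_derivative bump_deriv \<eta> (Suc m) j l t) (at t)"
proof (induction m arbitrary: j l)
  case 0
  have 1: "((\<lambda>t. inv_exp_deriv j 0 (\<eta> + t)) has_real_derivative inv_exp_deriv (Suc j) 0 (\<eta> + t) * 1) (at t)" for j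
    by (rule DERIV_chain2[OF has_real_derivative_inv_exp_deriv]) (auto intro!: derivative_eq_intros)
  have 2: "((\<lambda>t. inv_exp_deriv j 0 (\<eta> - t)) has_real_derivative inv_exp_deriv (Suc j) 0 (\<eta> - t) * (-1)) (at t)" for j
    by (rule DERIV_chain2[OF has_real_derivative_inv_exp_deriv]) (auto intro!: derivative_eq_intros)
  show ?case
    unfolding bump_deriv.simps[abs_def] using DERIV_mult[OF 1[of j] 2[of l]]
    by (simp add: algebra_simps del: inv_exp_deriv.simps)
next
  case (Suc m)
  show ?case unfolding bump_deriv.simps(2)[of \<eta> m j l, abs_def]
    using DERIV_diff[OF Suc[of "Suc j" l] Suc[of j "Suc l"]] by simp
qed

lemma bump_deriv_eq_0: "\<bar>t\<bar> \<ge> \<eta> \<Longrightarrow> bump_deriv \<eta> m j l t = 0"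
  by (induction m arbitrary: j l) (auto simp: inv_exp_deriv_nonpos abs_if split: if_splits)

text \<open>The kernel is the normalised product of exp (- 1/(\<eta> + t)) and exp (- 1/(\<eta> -
  t)). Its mass is stated on an interval twice as wide as the support, which leaves room for
  translating the kernel by less than \<eta> inside a fixed domain of integration.\<close>

lemma smooth_kernel:
  fixes \<eta> :: real
  assumes "\<eta> > 0"
  obtains k :: "nat \<Rightarrow> real \<Rightarrow> real" where
    "\<And>j t. (k j has_real_derivative k (Suc j) t) (at t)"
    "\<And>j t. \<bar>t\<bar> \<ge> \<eta> \<Longrightarrow> k j t = 0" "\<And>t. k 0 t \<ge> 0"
    "(k 0 has_integral 1) {-(2 * \<eta>)..2 * \<eta>}"
proof -
  let ?b = "bump_deriv \<eta> 0 0 0" and ?I = "{-(2 * \<eta>)..2 * \<eta>}"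
  have cont: "continuous_on UNIV (bump_deriv \<eta> m j l)" for m j l
    using has_real_derivative_bump_deriv by (meson DERIV_isCont continuous_at_imp_continuous_on)
  have nonneg: "?b t \<ge> 0" for t by (simp add: inv_exp_def)
  have int: "?b integrable_on ?I"
    by (rule integrable_continuous_real) (rule continuous_on_subset[OF cont], simp)
  have "integral ?I ?b \<noteq> 0"
  proof
    assume "integral ?I ?b = 0"
    moreover have "?b 0 \<noteq> 0" using assms by (simp add: inv_exp_def)
    moreover have "(0::real) \<in> ?I" using assms by simp
    ultimately show False
      using integral_eq_0_iff[of "-(2 * \<eta>)" "2 * \<eta>" ?b] continuous_on_subset[OF cont] nonneg assms
      by (metis (no_types, lifting) add.inverse_neutral linorder_not_less mult_pos_pos neg_less_iff_less order_less_trans subset_UNIV zero_less_numeral)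
  qed
  moreover have "integral ?I ?b \<ge> 0" by (rule integral_nonneg[OF int]) (rule nonneg)
  ultimately have pos: "integral ?I ?b > 0" by simp
  define k where "k m t = bump_deriv \<eta> m 0 0 t / integral ?I ?b" for m t
  show thesis
  proof
    show "(k j has_real_derivative k (Suc j) t) (at t)" for j t
      unfolding k_def by (rule DERIV_cdivide[OF has_real_derivative_bump_deriv])
    show "\<bar>t\<bar> \<ge> \<eta> \<Longrightarrow> k j t = 0" for j t by (simp add: k_def bump_deriv_eq_0 del: bump_deriv.simps)
    show "k 0 t \<ge> 0" for t using nonneg pos by (simp add: k_def del: bump_deriv.simps)
    show "(k 0 has_integral 1) ?I"
      unfolding k_def using has_integral_divide[OF integrable_integral[OF int], of "integral ?I ?b"] pos by simp
  qed
qed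

section \<open>A criterion for smoothness\<close>

text \<open>The estimate also bounds the set under the real supremum, and the zero tuple makes this
  set nonempty and the supremum nonnegative; hence even the absolute value is bounded.\<close>

lemma multilinear_norm_le:
  assumes "0 \<in> X" "K \<ge> 0" "\<And>vs. vs \<in> tuples k X \<Longrightarrow> norm (m vs) \<le> K * prod_list (map norm vs)"
  shows "norm (multilinear_norm k X m) \<le> K"
proof -
  let ?T = "tuples k (X \<inter> cball 0 1)"
  have "prod_list (map norm vs) \<le> 1" if "set vs \<subseteq> cball 0 1" for vs :: "'a list"
    using that by (induction vs) (auto intro!: mult_le_one prod_list_nonneg)
  then have bound: "norm (m vs) \<le> K" if "vs \<in> ?T" for vs
    using that assms(2) assms(3)[of vs] mult_left_mono[of "prod_list (map norm vs)" 1 K]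
    by (auto simp: tuples_def)
  have mem: "replicate k 0 \<in> ?T" using assms(1) by (auto simp: tuples_def)
  have "multilinear_norm k X m \<le> K"
    unfolding multilinear_norm_def using mem bound by (intro cSUP_least) auto
  moreover have "0 \<le> multilinear_norm k X m"
    unfolding multilinear_norm_def using bound mem
    by (intro order_trans[OF norm_ge_zero cSUP_upper[OF mem]]) (auto simp: bdd_above_def)
  ultimately show ?thesis by simp
qed

text \<open>A locally quadratic remainder serves both requirements: divided by the distance it still
  tends to 0, and together with the boundedness of the next derivative it gives continuity of the
  current one.\<close>

lemma C_infI:
  fixes f :: "'a::real_normed_vector \<Rightarrow> 'b::real_normed_vector"
  assumes "subspace X" "\<And>x. x \<in> X \<Longrightarrow> D 0 x [] = f x"
    and multi: "\<And>k x. x \<in> X \<Longrightarrow> bounded_multilinear_on k X (D k x)"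
    and taylor: "\<And>k x. x \<in> X \<Longrightarrow> \<exists>r>0. \<exists>K\<ge>0. \<forall>y\<in>X \<inter> ball x r. \<forall>vs\<in>tuples k X.
      norm (D k y vs - D k x vs - D (Suc k) x ((y - x) # vs))
        \<le> K * (norm (y - x))\<^sup>2 * prod_list (map norm vs)"
  shows "f \<in> C_inf X"
proof -
  have "((\<lambda>y. multilinear_norm k X (\<lambda>vs. D k y vs - D k x vs - D (Suc k) x ((y - x) # vs))
      / norm (y - x)) \<longlongrightarrow> 0) (at x within X) \<and>
    ((\<lambda>y. multilinear_norm k X (\<lambda>vs. D k y vs - D k x vs)) \<longlongrightarrow> 0) (at x within X)"
    if x: "x \<in> X" for k x
  proof -
    obtain r K where r: "r > 0" and K: "K \<ge> 0" and
      est: "\<And>y vs. y \<in> X \<Longrightarrow> y \<in> ball x r \<Longrightarrow> vs \<in> tuples k X \<Longrightarrow>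
        norm (D k y vs - D k x vs - D (Suc k) x ((y - x) # vs))
        \<le> K * (norm (y - x))\<^sup>2 * prod_list (map norm vs)"
      using taylor[OF x, of k] by blast
    obtain K0 where K0: "\<And>vs. vs \<in> tuples (Suc k) X \<Longrightarrow> norm (D (Suc k) x vs) \<le> K0 * prod_list (map norm vs)"
      using multi[OF x, of "Suc k"] unfolding bounded_multilinear_on_def by blast
    define K' where "K' = \<bar>K0\<bar>"
    have K': "norm (D (Suc k) x vs) \<le> K' * prod_list (map norm vs)" if "vs \<in> tuples (Suc k) X" for vs
      using K0[OF that] mult_right_mono[of K0 K' "prod_list (map norm vs)"] 
      by (force simp: K'_def intro!: prod_list_nonneg)
    have ev: "\<forall>\<^sub>F y in at x within X. y \<in> X \<and> y \<in> ball x r \<and> y \<noteq> x"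
      using r by (auto simp: eventually_at dist_commute)
    have 1: "norm (multilinear_norm k X (\<lambda>vs. D k y vs - D k x vs - D (Suc k) x ((y - x) # vs)))
         \<le> K * (norm (y - x))\<^sup>2" if "y \<in> X" "y \<in> ball x r" for y
      using est[OF that] K by (intro multilinear_norm_le subspace_0 assms(1)) auto
    have 2: "norm (multilinear_norm k X (\<lambda>vs. D k y vs - D k x vs))
         \<le> K * (norm (y - x))\<^sup>2 + K' * norm (y - x)" if "y \<in> X" "y \<in> ball x r" for y
    proof (intro multilinear_norm_le subspace_0 assms(1))
      show "0 \<le> K * (norm (y - x))\<^sup>2 + K' * norm (y - x)" using K by (simp add: K'_def)
      fix vs assume vs: "vs \<in> tuples k X"
      have "(y - x) # vs \<in> tuples (Suc k) X"
        using vs subspace_diff[OF assms(1) that(1) x] by (auto simp: tuples_def)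
      from norm_triangle_mono[OF est[OF that vs] K'[OF this]]
      show "norm (D k y vs - D k x vs) \<le> (K * (norm (y - x))\<^sup>2 + K' * norm (y - x)) * prod_list (map norm vs)"
        by (simp add: algebra_simps)
    qed
    have lim: "((\<lambda>y. norm (y - x)) \<longlongrightarrow> 0) (at x within X)"
      by (rule tendsto_eq_intros refl | simp)+
    show ?thesis
    proof
      have "((\<lambda>y. K * norm (y - x)) \<longlongrightarrow> 0) (at x within X)"
        by (rule tendsto_eq_intros lim refl | simp)+
      then show "((\<lambda>y. multilinear_norm k X (\<lambda>vs. D k y vs - D k x vs - D (Suc k) x ((y - x) # vs))
          / norm (y - x)) \<longlongrightarrow> 0) (at x within X)"
      proof (rule Lim_null_comparison[rotated])
        show "\<forall>\<^sub>F y in at x within X. norm (multilinear_norm k X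
            (\<lambda>vs. D k y vs - D k x vs - D (Suc k) x ((y - x) # vs)) / norm (y - x)) \<le> K * norm (y - x)"
          using ev by eventually_elim (use 1 in \<open>auto simp: divide_simps power2_eq_square mult.assoc\<close>)
      qed
      have "((\<lambda>y. K * (norm (y - x))\<^sup>2 + K' * norm (y - x)) \<longlongrightarrow> 0) (at x within X)"
        by (rule tendsto_eq_intros lim refl | simp)+
      then show "((\<lambda>y. multilinear_norm k X (\<lambda>vs. D k y vs - D k x vs)) \<longlongrightarrow> 0) (at x within X)"
        by (rule Lim_null_comparison[rotated]) (use ev in eventually_elim, use 2 in auto)
    qed
  qed
  with assms show ?thesis unfolding C_inf_def frechet_derivatives_def by blast
qed

section \<open>Coordinates\<close>

definition unit_czero :: "'i \<Rightarrow> 'i czero" where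
  "unit_czero i = Abs_czero (\<lambda>j. if j = i then 1 else 0)"

definition restrict_czero :: "'i set \<Rightarrow> 'i czero \<Rightarrow> 'i czero" where
  "restrict_czero U x = Abs_czero (\<lambda>i. if i \<in> U then coord x i else 0)"

lemma null_family_mono:
  assumes "null_family x" "\<And>i. \<bar>y i\<bar> \<le> \<bar>x i\<bar>"
  shows "null_family y"
  using assms unfolding null_family_def by (meson order_trans)

lemma coord_unit: "coord (unit_czero i) j = (if j = i then 1 else 0)"
  unfolding unit_czero_def
  by (subst coord_Abs) (auto simp: null_family_def intro!: exI[of _ "{i}"])

lemma coord_restrict: "coord (restrict_czero U x) i = (if i \<in> U then coord x i else 0)"
  unfolding restrict_czero_def
  by (subst coord_Abs) (auto intro: null_family_mono[OF null_family_coord[of x]])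

lemmas coord_simps = coord_zero coord_add coord_scaleR coord_uminus coord_diff coord_unit coord_restrict

lemma norm_unit: "norm (unit_czero i) = 1"
  using coord_le_norm[of "unit_czero i" i]
  by (intro antisym norm_czero_le) (auto simp: coord_unit)

lemma norm_restrict_le: "norm (restrict_czero U x) \<le> norm x"
  by (intro norm_czero_le) (auto simp: coord_restrict coord_le_norm)

lemma restrict_insert:
  "i \<notin> U \<Longrightarrow> restrict_czero (insert i U) x = restrict_czero U x + coord x i *\<^sub>R unit_czero i"
  by (rule czero_eqI) (auto simp: coord_simps)

lemma restrict_diff: "restrict_czero U x - restrict_czero U y = restrict_czero U (x - y)"
  by (rule czero_eqI) (auto simp: coord_simps)

section \<open>Taylor estimates from partial derivatives\<close>

definition inc :: "('i \<Rightarrow> nat) \<Rightarrow> 'i \<Rightarrow> 'i \<Rightarrow> nat" where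
  "inc n i = n(i := Suc (n i))"

lemma inc_commute: "inc (inc n i) j = inc (inc n j) i"
  by (auto simp: inc_def fun_eq_iff)

text \<open>Unfolded, this is the sum over all index tuples in \<open>S\<close> of the product of
  the corresponding coordinates times a mixed partial derivative; \<open>n\<close> records the
  partial derivatives already taken. Multi-indices make the symmetry of higher derivatives
  automatic.\<close>

primrec derivative_sum ::
  "'i set \<Rightarrow> (('i \<Rightarrow> nat) \<Rightarrow> 'i czero \<Rightarrow> 'b::real_vector) \<Rightarrow> ('i \<Rightarrow> nat) \<Rightarrow> 'i czero \<Rightarrow> 'i czero list \<Rightarrow> 'b" where
  "derivative_sum S P n x [] = P n x"
| "derivative_sum S P n x (v # vs) = (\<Sum>i\<in>S. coord v i *\<^sub>R derivative_sum S P (inc n i) x vs)"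

text \<open>
  A map of finitely many coordinates with all its partial derivatives: \<open>P n\<close> is the derivative
  of multi-index \<open>n\<close>.
\<close>

locale partial_derivatives =
  fixes S :: "'i set" and P :: "('i \<Rightarrow> nat) \<Rightarrow> 'i czero \<Rightarrow> 'b::real_normed_vector"
  assumes finite_S: "finite S"
    and bounded: "\<exists>K. \<forall>x. norm x \<le> R \<longrightarrow> norm (P n x) \<le> K"
    and partial: "i \<in> S \<Longrightarrow>
      ((\<lambda>s. P n (x + s *\<^sub>R unit_czero i)) has_vector_derivative P (inc n i) x) (at 0)"
    and local: "(\<And>i. i \<in> S \<Longrightarrow> coord x i = coord y i) \<Longrightarrow> P n x = P n y"
begin

lemma partial_at:
  assumes "i \<in> S"
  shows "((\<lambda>s. P n (x + s *\<^sub>R unit_czero i)) has_vector_derivative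
    P (inc n i) (x + s *\<^sub>R unit_czero i)) (at s)"
proof -
  have "((\<lambda>s'. s' - s) has_vector_derivative 1) (at s)"
    by (auto intro!: derivative_eq_intros)
  moreover have "((\<lambda>s'. P n ((x + s *\<^sub>R unit_czero i) + s' *\<^sub>R unit_czero i)) has_vector_derivative
      P (inc n i) (x + s *\<^sub>R unit_czero i)) (at (s - s))"
    using partial[OF assms] by simp
  ultimately have "((\<lambda>s'. P n ((x + s *\<^sub>R unit_czero i) + s' *\<^sub>R unit_czero i)) \<circ> (\<lambda>s'. s' - s)
      has_vector_derivative 1 *\<^sub>R P (inc n i) (x + s *\<^sub>R unit_czero i)) (at s)"
    by (rule vector_diff_chain_at)
  then show ?thesis by (simp add: o_def scaleR_left_diff_distrib)
qed

text \<open>The mean value inequality for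
  \<open>P n (x + s *\<^sub>R unit_czero i) - s *\<^sub>R c\<close> as a function of
  \<open>s\<close>. The vector \<open>c\<close> is free: 0 yields Lipschitz bounds, the partial
  derivative at \<open>x\<close> yields Taylor bounds.\<close>

lemma partial_increment:
  assumes "i \<in> S"
    and bd: "\<And>s'. \<bar>s'\<bar> \<le> \<bar>s\<bar> \<Longrightarrow> norm (P (inc n i) (x + s' *\<^sub>R unit_czero i) - c) \<le> B"
  shows "norm (P n (x + s *\<^sub>R unit_czero i) - P n x - s *\<^sub>R c) \<le> \<bar>s\<bar> * B"
proof -
  have "((\<lambda>s. P n (x + s *\<^sub>R unit_czero i)) has_derivative (\<lambda>h. h *\<^sub>R P (inc n i) (x + s' *\<^sub>R unit_czero i)))
      (at s' within closed_segment 0 s)" for s'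
    using partial_at[OF assms(1)] has_derivative_at_withinI unfolding has_vector_derivative_def by blast
  moreover have "onorm (\<lambda>h. h *\<^sub>R P (inc n i) (x + s' *\<^sub>R unit_czero i) - h *\<^sub>R c) \<le> B"
    if "s' \<in> closed_segment 0 s" for s'
  proof (rule onorm_le)
    have "\<bar>s'\<bar> \<le> \<bar>s\<bar>" using that by (auto simp: closed_segment_eq_real_ivl split: if_splits)
    then show "norm (h *\<^sub>R P (inc n i) (x + s' *\<^sub>R unit_czero i) - h *\<^sub>R c) \<le> B * norm h" for h :: real
      unfolding scaleR_right_diff_distrib[symmetric] norm_scaleR
      using mult_left_mono[OF bd, of s' "\<bar>h\<bar>"] by (simp add: mult.commute)
  qed
  ultimately have "norm ((P n (x + s *\<^sub>R unit_czero i) - s *\<^sub>R c) - (P n (x + 0 *\<^sub>R unit_czero i) - 0 *\<^sub>R c))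
      \<le> B * norm (s - 0)"
    by (intro differentiable_bound[of "closed_segment 0 s" "\<lambda>s. P n (x + s *\<^sub>R unit_czero i) - s *\<^sub>R c"
        "\<lambda>s' h. h *\<^sub>R P (inc n i) (x + s' *\<^sub>R unit_czero i) - h *\<^sub>R c"])
      (auto intro!: derivative_eq_intros)
  then show ?thesis by (simp add: algebra_simps)
qed

text \<open>The path from \<open>x\<close> to \<open>y\<close> changes one coordinate of
  \<open>S\<close> at a time, and each step is controlled by a bound for one partial derivative.
  \<open>P\<close> does not see the coordinates outside \<open>S\<close>.\<close>

lemma lipschitz_on_balls:
  "\<exists>K\<ge>0. \<forall>x y. norm x \<le> R \<longrightarrow> norm y \<le> R \<longrightarrow> norm (P n y - P n x) \<le> K * norm (y - x)"
proof -
  have "\<exists>K\<ge>0. \<forall>x h. norm x \<le> R' \<longrightarrow> norm h \<le> R' \<longrightarrow>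
      norm (P n (x + restrict_czero U h) - P n x) \<le> K * norm h" if "U \<subseteq> S" for U R'
    using finite_subset[OF that finite_S] that
  proof (induction U)
    case empty
    have "restrict_czero {} h = 0" for h :: "'i czero" by (rule czero_eqI) (simp add: coord_simps)
    then show ?case by (intro exI[of _ 0]) auto
  next
    case (insert j U)
    then obtain K where K: "K \<ge> 0" "\<And>x h. norm x \<le> R' \<Longrightarrow> norm h \<le> R' \<Longrightarrow>
      norm (P n (x + restrict_czero U h) - P n x) \<le> K * norm h" by auto
    \<comment> \<open>The base point, the increment along \<open>U\<close> and the step in
      coordinate \<open>j\<close> have norm at most \<open>R'\<close> each.\<close>
    obtain B where B: "\<And>x. norm x \<le> 3 * R' \<Longrightarrow> norm (P (inc n j) x) \<le> B"
      using bounded by blast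
    have "norm (P n (x + restrict_czero (insert j U) h) - P n x) \<le> (K + \<bar>B\<bar>) * norm h"
      if xh: "norm x \<le> R'" "norm h \<le> R'" for x h
    proof -
      let ?z = "x + restrict_czero U h"
      have "norm (P n (?z + coord h j *\<^sub>R unit_czero j) - P n ?z - coord h j *\<^sub>R 0) \<le> \<bar>coord h j\<bar> * \<bar>B\<bar>"
      proof (rule partial_increment)
        show "j \<in> S" using insert by simp
        fix s assume s: "\<bar>s\<bar> \<le> \<bar>coord h j\<bar>"
        have "norm (?z + s *\<^sub>R unit_czero j) \<le> norm x + norm (restrict_czero U h) + norm (s *\<^sub>R unit_czero j)"
          by (meson add_mono norm_triangle_ineq norm_triangle_le order_refl)
        also have "\<dots> \<le> 3 * R'"
          using s coord_le_norm[of h j] norm_restrict_le[of U h] xh by (simp add: norm_unit)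
        finally show "norm (P (inc n j) (?z + s *\<^sub>R unit_czero j) - 0) \<le> \<bar>B\<bar>" using B by force
      qed
      also have "\<dots> \<le> norm h * \<bar>B\<bar>" by (intro mult_right_mono coord_le_norm) simp
      finally have "norm (P n (x + restrict_czero (insert j U) h) - P n ?z) \<le> norm h * \<bar>B\<bar>"
        using insert by (simp add: restrict_insert add.assoc)
      from norm_triangle_mono[OF this K(2)[OF xh]] show ?thesis by (simp add: algebra_simps)
    qed
    then show ?case using K(1) by (intro exI[of _ "K + \<bar>B\<bar>"]) auto
  qed
  \<comment> \<open>The increment \<open>y - x\<close> may be as long as
    \<open>2 * R\<close>.\<close>
  from this[of S "2 * R"] obtain K where K: "K \<ge> 0" "\<And>x h. norm x \<le> 2 * R \<Longrightarrow> norm h \<le> 2 * R \<Longrightarrow>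
      norm (P n (x + restrict_czero S h) - P n x) \<le> K * norm h" by auto
  have "norm (P n y - P n x) \<le> K * norm (y - x)" if "norm x \<le> R" "norm y \<le> R" for x y
  proof -
    have "P n (x + restrict_czero S (y - x)) = P n y" by (rule local) (simp add: coord_simps)
    moreover have "norm (y - x) \<le> 2 * R" using norm_triangle_ineq4[of y x] that by simp
    moreover have "norm x \<le> 2 * R" using that norm_ge_zero[of x] by linarith
    ultimately show ?thesis using K(2)[of x "y - x"] by simp
  qed
  with K(1) show ?thesis by blast
qed

text \<open>Again one coordinate is moved at a time. In each step the partial derivative is frozen
  at \<open>x\<close> instead of at the current point; by its Lipschitz bound this costs a multiple
  of \<open>norm h\<close>, and the step itself contributes the second factor
  \<open>norm h\<close>.\<close>

lemma taylor:
  "\<exists>K\<ge>0. \<forall>x y. norm x \<le> R \<longrightarrow> norm y \<le> R \<longrightarrow>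
     norm (P n y - P n x - (\<Sum>i\<in>S. coord (y - x) i *\<^sub>R P (inc n i) x)) \<le> K * (norm (y - x))\<^sup>2"
proof -
  have "\<exists>K\<ge>0. \<forall>x h. norm x \<le> R' \<longrightarrow> norm h \<le> R' \<longrightarrow>
      norm (P n (x + restrict_czero U h) - P n x - (\<Sum>i\<in>U. coord h i *\<^sub>R P (inc n i) x)) \<le> K * (norm h)\<^sup>2"
    if "U \<subseteq> S" for U R'
    using finite_subset[OF that finite_S] that
  proof (induction U)
    case empty
    have "restrict_czero {} h = 0" for h :: "'i czero" by (rule czero_eqI) (simp add: coord_simps)
    then show ?case by (intro exI[of _ 0]) auto
  next
    case (insert j U)
    then obtain K where K: "K \<ge> 0" "\<And>x h. norm x \<le> R' \<Longrightarrow> norm h \<le> R' \<Longrightarrow>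
      norm (P n (x + restrict_czero U h) - P n x - (\<Sum>i\<in>U. coord h i *\<^sub>R P (inc n i) x)) \<le> K * (norm h)\<^sup>2" by auto
    obtain L where L: "L \<ge> 0" "\<And>x y. norm x \<le> 3 * R' \<Longrightarrow> norm y \<le> 3 * R' \<Longrightarrow>
        norm (P (inc n j) y - P (inc n j) x) \<le> L * norm (y - x)"
      using lipschitz_on_balls by meson
    have "norm (P n (x + restrict_czero (insert j U) h) - P n x - (\<Sum>i\<in>insert j U. coord h i *\<^sub>R P (inc n i) x))
        \<le> (K + 2 * L) * (norm h)\<^sup>2"
      if xh: "norm x \<le> R'" "norm h \<le> R'" for x h
    proof -
      let ?z = "x + restrict_czero U h" and ?c = "P (inc n j) x"
      have "norm (P n (?z + coord h j *\<^sub>R unit_czero j) - P n ?z - coord h j *\<^sub>R ?c)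
          \<le> \<bar>coord h j\<bar> * (L * (2 * norm h))"
      proof (rule partial_increment)
        show "j \<in> S" using insert by simp
        fix s assume s: "\<bar>s\<bar> \<le> \<bar>coord h j\<bar>"
        let ?w = "restrict_czero U h + s *\<^sub>R unit_czero j"
        have w: "norm ?w \<le> 2 * norm h"
          using norm_triangle_ineq[of "restrict_czero U h" "s *\<^sub>R unit_czero j"]
            s coord_le_norm[of h j] norm_restrict_le[of U h] by (simp add: norm_unit)
        then have "norm (x + ?w) \<le> 3 * R'" "norm x \<le> 3 * R'"
          using norm_triangle_ineq[of x ?w] xh norm_ge_zero[of x] by linarith+
        from L(2)[OF this(2,1)]
        have "norm (P (inc n j) (x + ?w) - ?c) \<le> L * norm ?w" by simp
        also have "\<dots> \<le> L * (2 * norm h)" by (intro mult_left_mono w L)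
        finally show "norm (P (inc n j) (?z + s *\<^sub>R unit_czero j) - ?c) \<le> L * (2 * norm h)"
          by (simp add: add.assoc)
      qed
      also have "\<dots> \<le> norm h * (L * (2 * norm h))" using L(1) by (intro mult_right_mono coord_le_norm) simp
      finally have "norm (P n (x + restrict_czero (insert j U) h) - P n ?z - coord h j *\<^sub>R ?c)
          \<le> norm h * (L * (2 * norm h))"
        using insert by (simp add: restrict_insert add.assoc)
      from norm_triangle_mono[OF this K(2)[OF xh]] insert(1,2) show ?thesis
        by (simp add: algebra_simps power2_eq_square)
    qed
    then show ?case using K(1) L(1) by (intro exI[of _ "K + 2 * L"]) auto
  qed
  from this[of S "2 * R"] obtain K where K: "K \<ge> 0" "\<And>x h. norm x \<le> 2 * R \<Longrightarrow> norm h \<le> 2 * R \<Longrightarrow>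
      norm (P n (x + restrict_czero S h) - P n x - (\<Sum>i\<in>S. coord h i *\<^sub>R P (inc n i) x)) \<le> K * (norm h)\<^sup>2" by auto
  have "norm (P n y - P n x - (\<Sum>i\<in>S. coord (y - x) i *\<^sub>R P (inc n i) x)) \<le> K * (norm (y - x))\<^sup>2"
    if "norm x \<le> R" "norm y \<le> R" for x y
  proof -
    have "P n (x + restrict_czero S (y - x)) = P n y" by (rule local) (simp add: coord_simps)
    moreover have "norm (y - x) \<le> 2 * R" using norm_triangle_ineq4[of y x] that by simp
    moreover have "norm x \<le> 2 * R" using that norm_ge_zero[of x] by linarith
    ultimately show ?thesis using K(2)[of x "y - x"] by simp
  qed
  with K(1) show ?thesis by blast
qed

lemma derivative_sum_linear:
  "derivative_sum S P n x (us @ (a *\<^sub>R v + b *\<^sub>R w) # vs)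
     = a *\<^sub>R derivative_sum S P n x (us @ v # vs) + b *\<^sub>R derivative_sum S P n x (us @ w # vs)"
  by (induction us arbitrary: n)
    (simp_all add: coord_simps scaleR_sum_right sum.distrib[symmetric] algebra_simps)

text \<open>Symmetry in the two leading directions. It allows an argument to be pulled out although
  the increment \<open>y - x\<close> stands in front of it.\<close>

lemma derivative_sum_swap:
  "derivative_sum S P n x (u # v # vs) = (\<Sum>i\<in>S. coord v i *\<^sub>R derivative_sum S P (inc n i) x (u # vs))"
  by (simp add: scaleR_sum_right, subst sum.swap, intro sum.cong refl)
    (simp add: inc_commute mult.commute)

lemma norm_coord_sum_le:
  assumes "\<And>i. i \<in> S \<Longrightarrow> norm (f i) \<le> K i * p" 
  shows "norm (\<Sum>i\<in>S. coord v i *\<^sub>R f i) \<le> (\<Sum>i\<in>S. K i) * (norm v * p)"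
proof -
  have "norm (coord v i *\<^sub>R f i) \<le> K i * (norm v * p)" if "i \<in> S" for i
  proof -
    have "norm (coord v i *\<^sub>R f i) \<le> norm v * (K i * p)"
      unfolding norm_scaleR by (intro mult_mono coord_le_norm assms that) auto
    then show ?thesis by (simp add: algebra_simps)
  qed
  then show ?thesis unfolding sum_distrib_right by (intro order_trans[OF norm_sum sum_mono])
qed

lemma derivative_sum_bounded:
  "\<exists>K\<ge>0. \<forall>(x :: 'i czero) vs. norm x \<le> R \<longrightarrow> length vs = k \<longrightarrow>
     norm (derivative_sum S P n x vs) \<le> K * prod_list (map norm vs)"
proof (induction k arbitrary: n)
  case 0
  obtain K where "\<And>x. norm x \<le> R \<Longrightarrow> norm (P n x) \<le> K" using bounded by blast
  then show ?case by (intro exI[of _ "\<bar>K\<bar>"]) force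
next
  case (Suc k)
  then have "\<forall>i. \<exists>K\<ge>0. \<forall>x vs. norm x \<le> R \<longrightarrow> length vs = k \<longrightarrow>
     norm (derivative_sum S P (inc n i) x vs) \<le> K * prod_list (map norm vs)" by blast
  then obtain K where K: "\<And>i. K i \<ge> 0" "\<And>i x vs. norm x \<le> R \<Longrightarrow> length vs = k \<Longrightarrow>
     norm (derivative_sum S P (inc n i) x vs) \<le> K i * prod_list (map norm vs)" by metis
  show ?case
  proof (intro exI[of _ "\<Sum>i\<in>S. K i"] conjI allI impI)
    show "0 \<le> (\<Sum>i\<in>S. K i)" using K(1) by (rule sum_nonneg)
    fix x :: "'i czero" and vs :: "'i czero list" assume "norm x \<le> R" "length vs = Suc k"
    then show "norm (derivative_sum S P n x vs) \<le> (\<Sum>i\<in>S. K i) * prod_list (map norm vs)"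
      using K(2) by (cases vs) (auto intro!: norm_coord_sum_le)
  qed
qed

text \<open>Pulling out the first argument turns the remainder into a combination, weighted by the
  coordinates of this argument, of remainders for the next partial derivatives, to which the
  induction hypothesis applies.\<close>

lemma derivative_sum_taylor:
  "\<exists>K\<ge>0. \<forall>x y vs. norm x \<le> R \<longrightarrow> norm y \<le> R \<longrightarrow> length vs = k \<longrightarrow>
     norm (derivative_sum S P n y vs - derivative_sum S P n x vs - derivative_sum S P n x ((y - x) # vs))
       \<le> K * (norm (y - x))\<^sup>2 * prod_list (map norm vs)"
proof (induction k arbitrary: n)
  case 0
  then show ?case using taylor[of R n] by simp
next
  case (Suc k)
  let ?E = "\<lambda>n x y vs. derivative_sum S P n y vs - derivative_sum S P n x vs
    - derivative_sum S P n x ((y - x) # vs)"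
  from Suc have "\<forall>i. \<exists>K\<ge>0. \<forall>x y vs. norm x \<le> R \<longrightarrow> norm y \<le> R \<longrightarrow> length vs = k \<longrightarrow>
     norm (?E (inc n i) x y vs) \<le> K * (norm (y - x))\<^sup>2 * prod_list (map norm vs)" by blast
  then obtain K where K: "\<And>i. K i \<ge> 0" "\<And>i x y vs. norm x \<le> R \<Longrightarrow> norm y \<le> R \<Longrightarrow> length vs = k \<Longrightarrow>
     norm (?E (inc n i) x y vs) \<le> K i * (norm (y - x))\<^sup>2 * prod_list (map norm vs)" by metis
  show ?case
  proof (intro exI[of _ "\<Sum>i\<in>S. K i"] conjI allI impI)
    show "0 \<le> (\<Sum>i\<in>S. K i)" using K(1) by (rule sum_nonneg)
    fix x y :: "'i czero" and ws :: "'i czero list" assume xy: "norm x \<le> R" "norm y \<le> R" and "length ws = Suc k"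
    then obtain v vs where ws: "ws = v # vs" "length vs = k" by (cases ws) auto
    have "?E n x y ws = (\<Sum>i\<in>S. coord v i *\<^sub>R ?E (inc n i) x y vs)"
      unfolding ws(1) derivative_sum_swap
      by (simp only: derivative_sum.simps(2)[of S P n _ v vs] scaleR_right_diff_distrib sum_subtractf)
    also have "norm \<dots> \<le> (\<Sum>i\<in>S. K i) * (norm v * ((norm (y - x))\<^sup>2 * prod_list (map norm vs)))"
      by (rule norm_coord_sum_le) (use K(2)[OF xy ws(2)] in \<open>simp add: mult.assoc\<close>)
    finally show "norm (?E n x y ws) \<le> (\<Sum>i\<in>S. K i) * (norm (y - x))\<^sup>2 * prod_list (map norm ws)"
      by (simp add: ws algebra_simps)
  qed
qed

end

section \<open>Mollification in finitely many coordinates\<close>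

text \<open>Boundedness on balls is a separate requirement: balls are not compact in infinite
  dimensions, so continuity does not give it.\<close>

definition tame :: "('a::real_normed_vector \<Rightarrow> 'b::real_normed_vector) \<Rightarrow> bool" where
  "tame g \<longleftrightarrow> continuous_on UNIV g \<and> (\<forall>R. \<exists>K. \<forall>x. norm x \<le> R \<longrightarrow> norm (g x) \<le> K)"

lemma tame_const: "tame (\<lambda>_. c)"
  unfolding tame_def by (intro conjI continuous_on_const allI exI[of _ "norm c"]) simp

text \<open>
  Convolutions in different coordinates commute only on sufficiently regular functions. Acting
  as the identity on all others makes them commute outright, so that they can be folded over a
  finite set of coordinates.
\<close>

definition convolve :: "real \<Rightarrow> (real \<Rightarrow> real) \<Rightarrow> 'i \<Rightarrow> ('i czero \<Rightarrow> 'b::banach) \<Rightarrow> 'i czero \<Rightarrow> 'b" where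
  "convolve M c i g = (if tame g
     then (\<lambda>x. integral {-M..M} (\<lambda>t. c t *\<^sub>R g (x - t *\<^sub>R unit_czero i))) else g)"

lemma convolve_eq:
  "tame g \<Longrightarrow> convolve M c i g x = integral {-M..M} (\<lambda>t. c t *\<^sub>R g (x - t *\<^sub>R unit_czero i))"
  by (simp add: convolve_def)

lemma continuous_convolve_integrand:
  assumes "tame g" "continuous_on UNIV c"
  shows "continuous_on T (\<lambda>t. c t *\<^sub>R g (x - t *\<^sub>R unit_czero i))"
proof -
  have g: "continuous_on UNIV g" using assms(1) by (simp add: tame_def)
  show ?thesis
    by (intro continuous_intros continuous_on_compose2[OF g] continuous_on_subset[OF assms(2)]) auto
qed

text \<open>An equivalence, because \<open>convolve\<close> leaves maps that are not tame unchanged;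
  tameness can thus be tracked through a fold without case distinctions.\<close>

lemma tame_convolve:
  assumes c: "continuous_on UNIV c" and "M \<ge> 0"
  shows "tame (convolve M c i g) = tame g"
proof (cases "tame g")
  case True
  then have g: "continuous_on UNIV g" and bd: "\<And>R. \<exists>K. \<forall>x. norm x \<le> R \<longrightarrow> norm (g x) \<le> K"
    by (auto simp: tame_def)
  have "continuous_on UNIV (\<lambda>x. integral (cbox (-M) M) (\<lambda>t. c t *\<^sub>R g (x - t *\<^sub>R unit_czero i)))"
    unfolding case_prod_beta
    by (intro integral_continuous_on_param)
      (auto intro!: continuous_intros continuous_on_compose2[OF g] continuous_on_compose2[OF c] simp: case_prod_beta)
  moreover have "\<exists>K. \<forall>x. norm x \<le> R \<longrightarrow> norm (convolve M c i g x) \<le> K" for R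
  proof -
    obtain K where K: "\<And>x. norm x \<le> R + M \<Longrightarrow> norm (g x) \<le> K" using bd by blast
    have "bounded (c ` {-M..M})"
      using c by (intro compact_imp_bounded compact_continuous_image) (auto intro: continuous_on_subset)
    then obtain B where "\<forall>y\<in>c ` {-M..M}. norm y \<le> B" unfolding bounded_iff by blast
    then have B: "\<And>t. t \<in> {-M..M} \<Longrightarrow> \<bar>c t\<bar> \<le> B" by auto
    have "norm (convolve M c i g x) \<le> (B * K) * (M - (-M))" if x: "norm x \<le> R" for x
      unfolding convolve_eq[OF True]
    proof (rule integral_bound)
      fix t assume t: "t \<in> {-M..M}"
      have "norm (x - t *\<^sub>R unit_czero i) \<le> R + M"
        using norm_triangle_ineq4[of x "t *\<^sub>R unit_czero i"] x t unfolding norm_scaleR norm_unit by auto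
      then show "norm (c t *\<^sub>R g (x - t *\<^sub>R unit_czero i)) \<le> B * K"
        unfolding norm_scaleR using t by (intro mult_mono B K) (use B[OF t] in auto)
    qed (use \<open>M \<ge> 0\<close> continuous_convolve_integrand[OF True c] in auto)
    then show ?thesis by blast
  qed
  ultimately show ?thesis using True by (simp add: tame_def convolve_def)
qed (simp add: convolve_def)

text \<open>Fubini for continuous integrands. The two kernels may differ, as derivatives of
  different orders act in different coordinates.\<close>

lemma convolve_commute:
  assumes c: "continuous_on UNIV c" and d: "continuous_on UNIV d" and "M \<ge> 0"
  shows "convolve M c i (convolve M d j g) = convolve M d j (convolve M c i g)"
proof (cases "tame g")
  case True
  then have g: "continuous_on UNIV g" by (simp add: tame_def)
  show ?thesis
  proof
    fix x
    let ?f = "\<lambda>t s. (c t * d s) *\<^sub>R g (x - t *\<^sub>R unit_czero i - s *\<^sub>R unit_czero j)"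
    have scale: "a *\<^sub>R integral I (\<lambda>s. e s *\<^sub>R F s) = integral I (\<lambda>s. (a * e s) *\<^sub>R F s)"
      for a :: real and I e and F :: "real \<Rightarrow> 'b"
      by (simp only: scaleR_scaleR[symmetric] integral_cmul)
    have tame: "tame (convolve M c i g)" "tame (convolve M d j g)"
      by (simp_all add: True tame_convolve[OF c \<open>M \<ge> 0\<close>] tame_convolve[OF d \<open>M \<ge> 0\<close>])
    have "convolve M c i (convolve M d j g) x = integral (cbox (-M) M) (\<lambda>t. integral (cbox (-M) M) (?f t))"
      by (simp only: convolve_eq[OF True] convolve_eq[OF tame(2)] scale cbox_interval)
    also have "\<dots> = integral (cbox (-M) M) (\<lambda>s. integral (cbox (-M) M) (\<lambda>t. ?f t s))"
      by (rule integral_swap_continuous)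
        (auto simp: case_prod_beta intro!: continuous_intros continuous_on_compose2[OF g]
          continuous_on_compose2[OF c] continuous_on_compose2[OF d])
    also have "?f = (\<lambda>t s. (d s * c t) *\<^sub>R g (x - s *\<^sub>R unit_czero j - t *\<^sub>R unit_czero i))"
      by (simp add: diff_diff_eq add.commute mult.commute)
    also have "integral (cbox (-M) M) (\<lambda>s. integral (cbox (-M) M) (\<lambda>t.
        (d s * c t) *\<^sub>R g (x - s *\<^sub>R unit_czero j - t *\<^sub>R unit_czero i)))
      = convolve M d j (convolve M c i g) x"
      by (simp only: convolve_eq[OF True] convolve_eq[OF tame(1)] scale cbox_interval)
    finally show "convolve M c i (convolve M d j g) x = convolve M d j (convolve M c i g) x" .
  qed
qed (simp add: convolve_def)

locale smoothing_kernel =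
  fixes \<eta> :: real and k :: "nat \<Rightarrow> real \<Rightarrow> real"
  assumes \<eta>_pos: "\<eta> > 0"
    and kernel_deriv: "(k j has_real_derivative k (Suc j) t) (at t)"
    and kernel_support: "\<bar>t\<bar> \<ge> \<eta> \<Longrightarrow> k j t = 0"
    and kernel_nonneg: "k 0 t \<ge> 0"
    and kernel_integral: "(k 0 has_integral 1) {-(2 * \<eta>)..2 * \<eta>}"
begin

lemma continuous_kernel: "continuous_on UNIV (k j)"
  using kernel_deriv by (meson DERIV_isCont continuous_at_imp_continuous_on)

abbreviation conv :: "nat \<Rightarrow> 'i \<Rightarrow> ('i czero \<Rightarrow> 'b::banach) \<Rightarrow> 'i czero \<Rightarrow> 'b" where
  "conv j \<equiv> convolve (2 * \<eta>) (k j)"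

lemma tame_conv: "tame (conv j i g) = tame g"
  using \<eta>_pos by (intro tame_convolve continuous_kernel) simp

text \<open>\<open>k 0\<close> is a probability density supported in \<bar>t\<bar> \<le> \<eta>, so
  the left side is the norm of an average of differences bounded by \<open>B\<close>. Two maps are
  allowed so that one of them can be a constant.\<close>

lemma conv_diff_le:
  assumes "tame g" "tame g'"
    and "\<And>t. \<bar>t\<bar> \<le> \<eta> \<Longrightarrow> norm (g (x - t *\<^sub>R unit_czero i) - g' (x' - t *\<^sub>R unit_czero i)) \<le> B"
  shows "norm (conv 0 i g x - conv 0 i g' x') \<le> B"
proof -
  let ?I = "{-(2 * \<eta>)..2 * \<eta>}"
  have int: "(\<lambda>t. k 0 t *\<^sub>R h (z - t *\<^sub>R unit_czero i)) integrable_on ?I" if "tame h" for h :: "'a czero \<Rightarrow> 'b" and z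
    by (intro integrable_continuous_real continuous_convolve_integrand that continuous_kernel)
  have "conv 0 i g x - conv 0 i g' x'
      = integral ?I (\<lambda>t. k 0 t *\<^sub>R (g (x - t *\<^sub>R unit_czero i) - g' (x' - t *\<^sub>R unit_czero i)))"
    using assms(1,2) by (simp add: convolve_eq scaleR_right_diff_distrib integral_diff int)
  also have "norm \<dots> \<le> integral ?I (\<lambda>t. k 0 t * B)"
  proof (rule integral_norm_bound_integral)
    show "(\<lambda>t. k 0 t *\<^sub>R (g (x - t *\<^sub>R unit_czero i) - g' (x' - t *\<^sub>R unit_czero i))) integrable_on ?I"
      using assms(1,2) by (simp add: scaleR_right_diff_distrib integrable_diff int)
    show "(\<lambda>t. k 0 t * B) integrable_on ?I"
      by (intro integrable_on_mult_left has_integral_integrable[OF kernel_integral])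
    fix t show "norm (k 0 t *\<^sub>R (g (x - t *\<^sub>R unit_czero i) - g' (x' - t *\<^sub>R unit_czero i))) \<le> k 0 t * B"
      using kernel_support[of t 0] assms(3)[of t] kernel_nonneg[of t]
      by (cases "\<bar>t\<bar> \<le> \<eta>") (auto simp: mult_left_mono)
  qed
  also have "\<dots> = B"
    using integral_unique[OF kernel_integral] by simp
  finally show ?thesis .
qed

lemma conv_cong:
  assumes "tame g" "tame g'"
    and "\<And>t. \<bar>t\<bar> \<le> \<eta> \<Longrightarrow> g (x - t *\<^sub>R unit_czero i) = g' (x' - t *\<^sub>R unit_czero i)"
  shows "conv j i g x = conv j i g' x'"
  unfolding convolve_eq[OF assms(1)] convolve_eq[OF assms(2)]
proof (rule integral_cong)
  fix t show "k j t *\<^sub>R g (x - t *\<^sub>R unit_czero i) = k j t *\<^sub>R g' (x' - t *\<^sub>R unit_czero i)"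
    using assms(3)[of t] kernel_support[of t j] by (cases "\<bar>t\<bar> \<le> \<eta>") auto
qed

text \<open>The kernel has mass 1, and its derivatives integrate to 0 by the fundamental theorem of
  calculus, as all \<open>k m\<close> vanish at the ends of the interval. This is what removes
  inactive coordinates.\<close>

lemma conv_locally_const:
  assumes "tame g" "\<And>t. \<bar>t\<bar> \<le> \<eta> \<Longrightarrow> g (x - t *\<^sub>R unit_czero i) = y"
  shows "conv j i g x = (if j = 0 then y else 0)"
proof -
  let ?I = "{-(2 * \<eta>)..2 * \<eta>}"
  have "(k j has_integral (if j = 0 then 1 else 0)) ?I"
  proof (cases j)
    case (Suc m)
    have "(k (Suc m) has_integral (k m (2 * \<eta>) - k m (-(2 * \<eta>)))) ?I"
      using \<eta>_pos kernel_deriv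
      by (intro fundamental_theorem_of_calculus)
        (auto simp: has_real_derivative_iff_has_vector_derivative intro: has_vector_derivative_at_within)
    moreover have "k m (2 * \<eta>) = 0" "k m (-(2 * \<eta>)) = 0" using \<eta>_pos by (auto intro!: kernel_support)
    ultimately show ?thesis using Suc by simp
  qed (use kernel_integral in simp)
  from has_integral_scaleR_left[OF this, of y]
  have "integral ?I (\<lambda>t. k j t *\<^sub>R y) = (if j = 0 then y else 0)"
    by (intro integral_unique) (auto split: if_splits)
  moreover have "conv j i g x = conv j i (\<lambda>_. y) x"
    by (rule conv_cong) (use assms tame_const in auto)
  ultimately show ?thesis by (simp add: convolve_eq tame_const)
qed

text \<open>Substituting t + s for t moves the parameter from \<open>g\<close>, which is merely
  continuous, into the kernel, where differentiation under the integral is possible.\<close>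

lemma conv_has_vector_derivative:
  assumes "tame g"
  shows "((\<lambda>s. conv j i g (x + s *\<^sub>R unit_czero i)) has_vector_derivative conv (Suc j) i g x) (at 0)"
proof -
  define h where "h t = g (x - t *\<^sub>R unit_czero i)" for t
  let ?I = "{-(2 * \<eta>)..2 * \<eta>}"
  have g: "continuous_on UNIV g" using assms by (simp add: tame_def)
  have h: "continuous_on UNIV h"
    unfolding h_def by (intro continuous_intros continuous_on_compose2[OF g]) auto
  \<comment> \<open>For these \<open>s\<close> the support of the translated kernel stays inside the
    original domain of integration, so that the domain can be kept fixed.\<close>
  have shift: "conv j i g (x + s *\<^sub>R unit_czero i) = integral (cbox (-(2 * \<eta>)) (2 * \<eta>)) (\<lambda>t. k j (t + s) *\<^sub>R h t)"
    if s: "\<bar>s\<bar> < \<eta>" for s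
  proof -
    let ?q = "\<lambda>t. k j (t + s) *\<^sub>R h t" and ?J = "{-\<eta> - s..\<eta> - s}"
    have "?q integrable_on ?J"
      by (intro integrable_continuous_real continuous_intros continuous_on_compose2[OF continuous_kernel]
          continuous_on_compose2[OF h]) auto
    then obtain I where I: "(?q has_integral I) ?J" by blast
    have zero: "?q t = 0" if "t \<notin> ?J" for t using kernel_support[of "t + s" j] that by auto
    have int: "(?q has_integral I) {-(2 * \<eta>) - s..2 * \<eta> - s}" "(?q has_integral I) ?I"
      using s \<eta>_pos by (auto intro!: has_integral_on_superset[OF I zero])
    then have "integral {-(2 * \<eta>) - s..2 * \<eta> - s} ?q = integral ?I ?q"
      using int[THEN integral_unique] by simp
    moreover have "integral {-(2 * \<eta>) - s..2 * \<eta> - s} ?q = integral ?I (\<lambda>t. k j t *\<^sub>R h (t - s))"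
      using integral_shift_real_ivl[of "-(2 * \<eta>)" s "2 * \<eta>" "\<lambda>t. k j t *\<^sub>R h (t - s)"] by simp
    moreover have "conv j i g (x + s *\<^sub>R unit_czero i) = integral ?I (\<lambda>t. k j t *\<^sub>R h (t - s))"
      by (simp add: convolve_eq[OF assms] h_def algebra_simps)
    ultimately show ?thesis by simp
  qed
  have "((\<lambda>s. integral (cbox (-(2 * \<eta>)) (2 * \<eta>)) (\<lambda>t. k j (t + s) *\<^sub>R h t)) has_vector_derivative
      integral (cbox (-(2 * \<eta>)) (2 * \<eta>)) (\<lambda>t. k (Suc j) (t + 0) *\<^sub>R h t)) (at 0 within UNIV)"
  proof (rule leibniz_rule_vector_derivative)
    fix s t
    have "((\<lambda>s. k j (t + s)) has_real_derivative k (Suc j) (t + s) * 1) (at s)"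
      by (rule DERIV_chain2[OF kernel_deriv]) (auto intro!: derivative_eq_intros)
    then show "((\<lambda>s. k j (t + s) *\<^sub>R h t) has_vector_derivative k (Suc j) (t + s) *\<^sub>R h t) (at s within UNIV)"
      by (auto simp: has_vector_derivative_def has_field_derivative_def mult.commute intro!: derivative_eq_intros)
  qed (auto simp: case_prod_beta intro!: integrable_continuous_real continuous_intros
        continuous_on_compose2[OF continuous_kernel] continuous_on_compose2[OF h])
  then have "((\<lambda>s. conv j i g (x + s *\<^sub>R unit_czero i)) has_vector_derivative
      integral (cbox (-(2 * \<eta>)) (2 * \<eta>)) (\<lambda>t. k (Suc j) (t + 0) *\<^sub>R h t)) (at 0)"
    by (rule has_vector_derivative_transform_within_open[where S = "{-\<eta><..<\<eta>}"])
      (use \<eta>_pos shift in auto)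
  moreover have "conv (Suc j) i g x = integral (cbox (-(2 * \<eta>)) (2 * \<eta>)) (\<lambda>t. k (Suc j) (t + 0) *\<^sub>R h t)"
    by (simp add: convolve_eq[OF assms] h_def)
  ultimately show ?thesis by simp
qed

text \<open>\<open>n i\<close> selects the derivative of the kernel used in coordinate
  \<open>i\<close>, so partial derivatives of a mollification are again mollifications. Folding is
  legitimate because the convolutions commute.\<close>

definition mollify :: "('i \<Rightarrow> nat) \<Rightarrow> 'i set \<Rightarrow> ('i czero \<Rightarrow> 'b::banach) \<Rightarrow> 'i czero \<Rightarrow> 'b" where
  "mollify n S g = Finite_Set.fold (\<lambda>i. conv (n i) i) g S"

lemma mollify_empty: "mollify n {} g = g"
  by (simp add: mollify_def)

lemma mollify_insert:
  assumes "finite S" "i \<notin> S"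
  shows "mollify n (insert i S) g = conv (n i) i (mollify n S g)"
proof -
  interpret comp_fun_commute "\<lambda>i. conv (n i) i"
    by standard (use \<eta>_pos in \<open>auto simp: fun_eq_iff convolve_commute continuous_kernel\<close>)
  show ?thesis using assms by (simp add: mollify_def)
qed

lemma tame_mollify: "finite S \<Longrightarrow> tame (mollify n S g) = tame g"
  by (induction S rule: finite_induct) (auto simp: mollify_empty mollify_insert tame_conv)

lemma mollify_index_cong:
  "finite S \<Longrightarrow> (\<And>i. i \<in> S \<Longrightarrow> n i = m i) \<Longrightarrow> mollify n S g = mollify m S g"
  by (induction S rule: finite_induct) (auto simp: mollify_empty mollify_insert)

text \<open>\<open>r\<close> is an invariant of the shifts made by the convolutions: it holds for
  the given pair and has to force equality of the two maps once all shifts are made. Only values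
  within reach of the kernel are compared.\<close>

lemma mollify_cong:
  assumes "finite S" "tame g" "tame g'"
    and step: "\<And>x x' i t. i \<in> S \<Longrightarrow> \<bar>t\<bar> \<le> \<eta> \<Longrightarrow> r x x' \<Longrightarrow> r (x - t *\<^sub>R unit_czero i) (x' - t *\<^sub>R unit_czero i)"
    and base: "\<And>x x'. r x x' \<Longrightarrow> g x = g' x'"
    and "r x x'"
  shows "mollify n S g x = mollify n S g' x'"
  using assms(1) step \<open>r x x'\<close>
proof (induction S arbitrary: x x' rule: finite_induct)
  case (insert i S)
  show ?case unfolding mollify_insert[OF insert(1,2)]
    by (rule conv_cong) (use assms insert in \<open>auto simp: tame_mollify\<close>)
qed (simp add: mollify_empty base)

text \<open>The invariant \<open>r\<close> carries the set of coordinates still to be convolved. A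
  coordinate leaves this set when it is shifted, so each is shifted only once and displacements do
  not accumulate. All orders are 0 since the averages use a nonnegative kernel of mass 1.\<close>

lemma mollify_diff_le:
  assumes "finite S" "tame g" "tame g'"
    and step: "\<And>U x x' i t. i \<notin> U \<Longrightarrow> \<bar>t\<bar> \<le> \<eta> \<Longrightarrow> r (insert i U) x x' \<Longrightarrow>
      r U (x - t *\<^sub>R unit_czero i) (x' - t *\<^sub>R unit_czero i)"
    and base: "\<And>x x'. r {} x x' \<Longrightarrow> norm (g x - g' x') \<le> B"
    and "r S x x'"
  shows "norm (mollify (\<lambda>_. 0) S g x - mollify (\<lambda>_. 0) S g' x') \<le> B"
  using assms(1) \<open>r S x x'\<close>
proof (induction S arbitrary: x x' rule: finite_induct)
  case (insert i S)
  show ?case unfolding mollify_insert[OF insert(1,2)]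
    by (rule conv_diff_le) (use assms insert in \<open>auto simp: tame_mollify\<close>)
qed (simp add: mollify_empty base)

lemma mollify_const: "finite S \<Longrightarrow> mollify (\<lambda>_. 0) S (\<lambda>_. c) x = c"
  by (induction S arbitrary: x rule: finite_induct)
    (auto simp: mollify_empty mollify_insert tame_mollify tame_const intro!: conv_locally_const[where j = 0, simplified])

end

section \<open>Smoothing by soft thresholding and mollification\<close>

definition soft_threshold :: "real \<Rightarrow> 'i czero \<Rightarrow> 'i czero" where
  "soft_threshold a x = Abs_czero (\<lambda>i.
     if coord x i > a then coord x i - a else if coord x i < - a then coord x i + a else 0)"

lemma coord_soft_threshold:
  "a \<ge> 0 \<Longrightarrow> coord (soft_threshold a x) i =
    (if coord x i > a then coord x i - a else if coord x i < - a then coord x i + a else 0)"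
  unfolding soft_threshold_def
  by (subst coord_Abs) (auto intro!: null_family_mono[OF null_family_coord[of x]])

lemma norm_soft_threshold_diff_le:
  assumes "a \<ge> 0"
  shows "norm (soft_threshold a x - soft_threshold a y) \<le> norm (x - y)"
proof (rule norm_czero_le)
  fix i
  have "\<bar>coord (soft_threshold a x - soft_threshold a y) i\<bar> \<le> \<bar>coord (x - y) i\<bar>"
    using assms by (simp add: coord_diff coord_soft_threshold)
  then show "\<bar>coord (soft_threshold a x - soft_threshold a y) i\<bar> \<le> norm (x - y)"
    by (rule order_trans) (rule coord_le_norm)
qed

section \<open>The smooth approximant and its derivatives\<close>

context smoothing_kernel
begin

text \<open>The level is positive, which makes the set finite, and \<eta> / 2 + \<eta> < 2 * \<eta>,
  so that the kernel cannot lift the remaining coordinates over the threshold.\<close>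

definition active :: "'i czero \<Rightarrow> 'i set" where
  "active x = {i. \<bar>coord x i\<bar> > \<eta> / 2}"

lemma finite_superlevel: "a > 0 \<Longrightarrow> finite {i. \<bar>coord x i\<bar> > a}"
  using null_family_coord[of x] unfolding null_family_def
  by (metis (mono_tags, lifting) finite_subset linorder_not_less mem_Collect_eq subsetI)

lemma finite_active: "finite (active x)"
  unfolding active_def using \<eta>_pos by (intro finite_superlevel) simp

text \<open>Restriction to \<open>S\<close> makes the map depend on the coordinates in
  \<open>S\<close> alone, everywhere and not just near one point, as the Taylor estimates in
  finitely many coordinates require.\<close>

definition truncate :: "('i czero \<Rightarrow> 'b) \<Rightarrow> 'i set \<Rightarrow> 'i czero \<Rightarrow> 'b" where
  "truncate f S x = f (soft_threshold (2 * \<eta>) (restrict_czero S x))"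

lemma truncation_lipschitz:
  "norm (soft_threshold (2 * \<eta>) (restrict_czero S x) - soft_threshold (2 * \<eta>) (restrict_czero S y))
     \<le> norm (x - y)"
  using norm_soft_threshold_diff_le[of "2 * \<eta>" "restrict_czero S x" "restrict_czero S y"]
    norm_restrict_le[of S "x - y"] \<eta>_pos by (simp add: restrict_diff)

lemma tame_truncate:
  assumes "tame f"
  shows "tame (truncate f S)"
proof -
  let ?h = "\<lambda>x. soft_threshold (2 * \<eta>) (restrict_czero S x)"
  have "1-lipschitz_on UNIV ?h"
    by (rule lipschitz_onI) (auto simp: dist_norm truncation_lipschitz)
  then have cont: "continuous_on UNIV ?h" by (rule lipschitz_on_continuous_on)
  have "?h 0 = 0"
    using \<eta>_pos by (intro czero_eqI) (simp add: coord_soft_threshold coord_simps)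
  then have h: "norm (?h x) \<le> norm x" for x using truncation_lipschitz[of S x 0] by simp
  have "\<exists>K. \<forall>x. norm x \<le> R \<longrightarrow> norm (truncate f S x) \<le> K" for R
  proof -
    obtain K where "\<And>x. norm x \<le> R \<Longrightarrow> norm (f x) \<le> K" using assms unfolding tame_def by blast
    then show ?thesis unfolding truncate_def using order_trans[OF h] by (intro exI[of _ K]) simp
  qed
  moreover have "continuous_on UNIV (truncate f S)"
    unfolding truncate_def[abs_def] using assms
    by (intro continuous_on_compose2[of UNIV f UNIV ?h] cont) (auto simp: tame_def)
  ultimately show ?thesis using assms unfolding tame_def by blast
qed

definition partial_mollify :: "('i czero \<Rightarrow> 'b::banach) \<Rightarrow> 'i set \<Rightarrow> ('i \<Rightarrow> nat) \<Rightarrow> 'i czero \<Rightarrow> 'b" where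
  "partial_mollify f S n = mollify n S (truncate f S)"

text \<open>Since the convolutions commute, the one in coordinate \<open>i\<close> may be put
  outermost; differentiation in this direction then only replaces its kernel by the next
  derivative.\<close>

lemma partial_derivatives_partial_mollify:
  assumes "tame f" "finite S"
  shows "partial_derivatives S (partial_mollify f S)"
proof
  show "finite S" by fact
  show "\<exists>K. \<forall>x. norm x \<le> R \<longrightarrow> norm (partial_mollify f S n x) \<le> K" for R n
    using tame_mollify[OF assms(2), of n "truncate f S"] tame_truncate[OF assms(1)]
    unfolding partial_mollify_def tame_def by blast
  show "((\<lambda>s. partial_mollify f S n (x + s *\<^sub>R unit_czero i)) has_vector_derivative
      partial_mollify f S (inc n i) x) (at 0)" if "i \<in> S" for i n x
  proof -
    have S: "S = insert i (S - {i})" "finite (S - {i})" "i \<notin> S - {i}" using that assms(2) by auto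
    have eq: "partial_mollify f S m = conv (m i) i (mollify m (S - {i}) (truncate f S))" for m
      unfolding partial_mollify_def using mollify_insert[OF S(2,3)] S(1) by metis
    have "mollify (inc n i) (S - {i}) (truncate f S) = mollify n (S - {i}) (truncate f S)"
      by (rule mollify_index_cong) (use S in \<open>auto simp: inc_def\<close>)
    moreover have "tame (mollify n (S - {i}) (truncate f S))"
      using tame_mollify[OF S(2)] tame_truncate[OF assms(1)] by auto
    ultimately show ?thesis
      unfolding eq using conv_has_vector_derivative by (simp add: inc_def)
  qed
  show "partial_mollify f S n x = partial_mollify f S n y"
    if "\<And>i. i \<in> S \<Longrightarrow> coord x i = coord y i" for x y n
    unfolding partial_mollify_def
  proof (rule mollify_cong[where r = "\<lambda>x y. \<forall>i\<in>S. coord x i = coord y i"])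
    fix x y :: "'a czero" assume "\<forall>i\<in>S. coord x i = coord y i"
    then have "restrict_czero S x = restrict_czero S y"
      by (intro czero_eqI) (simp add: coord_simps)
    then show "truncate f S x = truncate f S y" by (simp add: truncate_def)
  qed (use that assms tame_truncate in \<open>auto simp: coord_simps\<close>)
qed

text \<open>A coordinate below half the kernel width is set to 0 by the threshold wherever the kernel looks.\<close>

lemma partial_mollify_inactive:
  assumes "tame f" "finite U" "i \<notin> U" "\<bar>coord x i\<bar> \<le> \<eta> / 2"
  shows "partial_mollify f (insert i U) n x = (if n i = 0 then partial_mollify f U n x else 0)"
  unfolding partial_mollify_def mollify_insert[OF assms(2,3)]
proof (rule conv_locally_const)
  show "tame (mollify n U (truncate f (insert i U)))"
    using assms by (simp add: tame_mollify tame_truncate)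
  fix t :: real assume t: "\<bar>t\<bar> \<le> \<eta>"
  show "mollify n U (truncate f (insert i U)) (x - t *\<^sub>R unit_czero i) = mollify n U (truncate f U) x"
  \<comment> \<open>The convolutions over \<open>U\<close> never shift coordinate \<open>i\<close>,
    so its bound \<eta> / 2 + \<eta> persists; the other coordinates are shifted equally on both
    sides.\<close>
  proof (rule mollify_cong[where r = "\<lambda>y z. (\<forall>j. j \<noteq> i \<longrightarrow> coord y j = coord z j) \<and> \<bar>coord y i\<bar> \<le> 3 / 2 * \<eta>"])
    fix y z :: "'a czero" assume yz: "(\<forall>j. j \<noteq> i \<longrightarrow> coord y j = coord z j) \<and> \<bar>coord y i\<bar> \<le> 3 / 2 * \<eta>"
    have "soft_threshold (2 * \<eta>) (restrict_czero (insert i U) y) = soft_threshold (2 * \<eta>) (restrict_czero U z)"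
    proof (rule czero_eqI)
      fix j
      show "coord (soft_threshold (2 * \<eta>) (restrict_czero (insert i U) y)) j
          = coord (soft_threshold (2 * \<eta>) (restrict_czero U z)) j"
        using yz \<eta>_pos assms(3) by (cases "j = i") (auto simp: coord_soft_threshold coord_simps abs_le_iff)
    qed
    then show "truncate f (insert i U) y = truncate f U z" by (simp add: truncate_def)
  next
    have "\<bar>coord x i - t\<bar> \<le> 3 / 2 * \<eta>" using assms(4) t by linarith
    then show "(\<forall>j. j \<noteq> i \<longrightarrow> coord (x - t *\<^sub>R unit_czero i) j = coord x j) \<and>
        \<bar>coord (x - t *\<^sub>R unit_czero i) i\<bar> \<le> 3 / 2 * \<eta>"
      by (simp add: coord_simps)
  qed (use assms tame_truncate in \<open>auto simp: coord_simps\<close>)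
qed

definition derivative_at :: "('i czero \<Rightarrow> 'b::banach) \<Rightarrow> 'i set \<Rightarrow> ('i \<Rightarrow> nat) \<Rightarrow> 'i czero \<Rightarrow> 'i czero list \<Rightarrow> 'b" where
  "derivative_at f S = derivative_sum S (partial_mollify f S)"

text \<open>A derivative already taken in the inactive direction \<open>i\<close> stays in the
  multi-index, and every mixed derivative containing it is 0.\<close>

lemma derivative_at_vanish:
  assumes "tame f" "finite U" "i \<notin> U" "\<bar>coord x i\<bar> \<le> \<eta> / 2" "n i \<noteq> 0"
  shows "derivative_at f (insert i U) n x vs = 0"
  using assms(5)
proof (induction vs arbitrary: n)
  case Nil
  then show ?case using partial_mollify_inactive[OF assms(1-4)] by (simp add: derivative_at_def)
next
  case (Cons v vs)
  have "inc n j i \<noteq> 0" for j using Cons(2) by (simp add: inc_def)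
  then show ?case using Cons(1) unfolding derivative_at_def by (simp add: sum.neutral)
qed

text \<open>The enlarged sums gain only terms with a derivative in direction \<open>i\<close>, which
  vanish; the other terms agree by induction.\<close>

lemma derivative_at_inactive:
  assumes "tame f" "finite U" "i \<notin> U" "\<bar>coord x i\<bar> \<le> \<eta> / 2" "n i = 0"
  shows "derivative_at f (insert i U) n x vs = derivative_at f U n x vs"
  using assms(5)
proof (induction vs arbitrary: n)
  case Nil
  then show ?case using partial_mollify_inactive[OF assms(1-4)] by (simp add: derivative_at_def)
next
  case (Cons v vs)
  have "derivative_at f (insert i U) (inc n j) x vs = derivative_at f U (inc n j) x vs" if "j \<in> U" for j
    using that Cons assms(3) by (intro Cons(1)) (auto simp: inc_def)
  moreover have "derivative_at f (insert i U) (inc n i) x vs = 0"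
    by (rule derivative_at_vanish) (use assms in \<open>auto simp: inc_def\<close>)
  ultimately show ?case using assms(2,3) unfolding derivative_at_def by simp
qed

text \<open>Inactive coordinates are added one at a time. Hence points with different active sets
  can be compared through any common finite superset.\<close>

lemma derivative_at_active:
  assumes "tame f" "finite S" "active x \<subseteq> S"
  shows "derivative_at f S (\<lambda>_. 0) x vs = derivative_at f (active x) (\<lambda>_. 0) x vs"
proof -
  have "derivative_at f (active x \<union> T) (\<lambda>_. 0) x vs = derivative_at f (active x) (\<lambda>_. 0) x vs"
    if "finite T" for T
    using that
  proof (induction T rule: finite_induct)
    case (insert i T)
    show ?case
    proof (cases "i \<in> active x \<union> T")
      case True
      then show ?thesis using insert by (metis Un_insert_right insert_absorb)
    next
      case False
      then show ?thesis
        using insert derivative_at_inactive[OF assms(1), of "active x \<union> T" i x "\<lambda>_. 0" vs] finite_active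
        by (auto simp: active_def)
    qed
  qed simp
  from this[OF assms(2)] show ?thesis using assms(3) by (simp add: Un_absorb1)
qed

text \<open>The set of averaged coordinates varies with the point; for tame maps
  \<open>smoothen_eq\<close> replaces it by any larger finite set.\<close>

definition smoothen :: "('i czero \<Rightarrow> 'b::banach) \<Rightarrow> 'i czero \<Rightarrow> 'b" where
  "smoothen f x = partial_mollify f (active x) (\<lambda>_. 0) x"

lemma smoothen_eq:
  assumes "tame f" "finite S" "active x \<subseteq> S"
  shows "smoothen f x = mollify (\<lambda>_. 0) S (truncate f S) x"
  using derivative_at_active[OF assms, of "[]"]
  by (simp add: smoothen_def derivative_at_def partial_mollify_def)

text \<open>Near \<open>x\<close> all active sets lie in one fixed finite set, so the candidate
  derivatives there are those of a single map of finitely many coordinates. The constant of the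
  quadratic estimate depends on this set and is therefore only local.\<close>

lemma C_inf_smoothen:
  fixes f :: "'i czero \<Rightarrow> 'b::banach"
  assumes f: "tame f" and X: "subspace X"
  shows "smoothen f \<in> C_inf X"
proof (rule C_infI[where D = "\<lambda>k x vs. derivative_at f (active x) (\<lambda>_. 0) x vs"])
  show "subspace X" by fact
  show "derivative_at f (active x) (\<lambda>_. 0) x [] = smoothen f x" for x
    by (simp add: derivative_at_def smoothen_def)
next
  fix k and x :: "'i czero"
  interpret partial_derivatives "active x" "partial_mollify f (active x)"
    by (intro partial_derivatives_partial_mollify f finite_active)
  have "\<exists>K. \<forall>vs\<in>tuples k X. norm (derivative_at f (active x) (\<lambda>_. 0) x vs) \<le> K * prod_list (map norm vs)"
    using derivative_sum_bounded[of "norm x" k "\<lambda>_. 0"] unfolding derivative_at_def tuples_def by blast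
  then show "bounded_multilinear_on k X (derivative_at f (active x) (\<lambda>_. 0) x)"
    unfolding bounded_multilinear_on_def using derivative_sum_linear by (simp add: derivative_at_def)
next
  fix k and x :: "'i czero"
  \<comment> \<open>Level and radius \<eta> / 4 add up to the activity level \<eta> / 2, so that
    \<open>S\<close> contains the active set of every point of the ball.\<close>
  define S where "S = {i. \<bar>coord x i\<bar> > \<eta> / 4}"
  have S: "finite S" unfolding S_def using \<eta>_pos by (intro finite_superlevel) simp
  interpret partial_derivatives S "partial_mollify f S"
    by (intro partial_derivatives_partial_mollify f S)
  have act: "active y \<subseteq> S" if "y \<in> ball x (\<eta> / 4)" for y
  proof
    fix i assume "i \<in> active y"
    then have "\<bar>coord y i\<bar> > \<eta> / 2" by (simp add: active_def)
    moreover have "\<bar>coord (x - y) i\<bar> < \<eta> / 4"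
      using that coord_le_norm[of "x - y" i] by (simp add: dist_norm)
    ultimately have "\<bar>coord x i\<bar> > \<eta> / 4" unfolding coord_diff by linarith
    then show "i \<in> S" by (simp add: S_def)
  qed
  have D: "derivative_at f (active y) (\<lambda>_. 0) y = derivative_sum S (partial_mollify f S) (\<lambda>_. 0) y"
    if "y \<in> ball x (\<eta> / 4)" for y
    using derivative_at_active[OF f S act[OF that]] by (auto simp: derivative_at_def fun_eq_iff)
  obtain K where K: "K \<ge> 0" "\<And>y vs. norm y \<le> norm x + \<eta> / 4 \<Longrightarrow> length vs = k \<Longrightarrow>
     norm (derivative_sum S (partial_mollify f S) (\<lambda>_. 0) y vs - derivative_sum S (partial_mollify f S) (\<lambda>_. 0) x vs
       - derivative_sum S (partial_mollify f S) (\<lambda>_. 0) x ((y - x) # vs))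
       \<le> K * (norm (y - x))\<^sup>2 * prod_list (map norm vs)"
    using derivative_sum_taylor[of "norm x + \<eta> / 4" k "\<lambda>_. 0"] \<eta>_pos by (metis add_increasing2 half_gt_zero less_eq_real_def linorder_not_less norm_ge_zero order_refl zero_less_divide_iff zero_less_numeral)
  show "\<exists>r>0. \<exists>K\<ge>0. \<forall>y\<in>X \<inter> ball x r. \<forall>vs\<in>tuples k X.
      norm (derivative_at f (active y) (\<lambda>_. 0) y vs - derivative_at f (active x) (\<lambda>_. 0) x vs
        - derivative_at f (active x) (\<lambda>_. 0) x ((y - x) # vs))
      \<le> K * (norm (y - x))\<^sup>2 * prod_list (map norm vs)"
  proof (rule exI[of _ "\<eta> / 4"], intro conjI exI[of _ K] ballI K(1))
    show "\<eta> / 4 > 0" using \<eta>_pos by simp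
    fix y vs assume y: "y \<in> X \<inter> ball x (\<eta> / 4)" and vs: "vs \<in> tuples k X"
    have "norm y \<le> norm x + \<eta> / 4"
      using y norm_triangle_ineq2[of y x] by (simp add: dist_norm norm_minus_commute)
    then show "norm (derivative_at f (active y) (\<lambda>_. 0) y vs - derivative_at f (active x) (\<lambda>_. 0) x vs
        - derivative_at f (active x) (\<lambda>_. 0) x ((y - x) # vs))
      \<le> K * (norm (y - x))\<^sup>2 * prod_list (map norm vs)"
      using K(2) vs y \<eta>_pos by (simp add: D tuples_def)
  qed
qed

text \<open>Both points are mollified over the union of their active sets. The averages use equal
  shifts at both points, which preserve their difference, and restriction and threshold do not
  increase its norm.\<close>

lemma norm_smoothen_diff_le:
  assumes f: "tame f"
    and B: "\<And>u v. norm (u - v) \<le> norm (x - y) \<Longrightarrow> norm (f u - f v) \<le> B"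
  shows "norm (smoothen f x - smoothen f y) \<le> B"
proof -
  let ?S = "active x \<union> active y"
  have S: "finite ?S" by (simp add: finite_active)
  have "norm (mollify (\<lambda>_. 0) ?S (truncate f ?S) x - mollify (\<lambda>_. 0) ?S (truncate f ?S) y) \<le> B"
  proof (rule mollify_diff_le[where r = "\<lambda>_ u v. u - v = x - y"])
    fix u v assume "u - v = x - y"
    then show "norm (truncate f ?S u - truncate f ?S v) \<le> B"
      unfolding truncate_def by (intro B) (metis truncation_lipschitz)
  qed (use S f tame_truncate in auto)
  then show ?thesis using smoothen_eq[OF f S] by simp
qed

text \<open>A constant map is its own mollification, which reduces the claim to the points reached
  by the kernel.\<close>

lemma norm_smoothen_minus_const_le:
  assumes f: "tame f"
    and B: "\<And>u. norm (u - x) \<le> 3 * \<eta> \<Longrightarrow> norm (f u - c) \<le> B"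
  shows "norm (smoothen f x - c) \<le> B"
proof -
  let ?S = "active x"
  have "norm (mollify (\<lambda>_. 0) ?S (truncate f ?S) x - mollify (\<lambda>_. 0) ?S (\<lambda>_. c) x) \<le> B"
  \<comment> \<open>Coordinates in \<open>U\<close> are still untouched, the shifted ones are off by
    at most \<eta>.\<close>
  proof (rule mollify_diff_le[where r = "\<lambda>U u v. (\<forall>i\<in>U. coord u i = coord x i) \<and> (\<forall>i. \<bar>coord (u - x) i\<bar> \<le> \<eta>)"])
    fix U and u v :: "'a czero" and i and t :: real
    assume "i \<notin> U" "\<bar>t\<bar> \<le> \<eta>"
      and "(\<forall>j\<in>insert i U. coord u j = coord x j) \<and> (\<forall>j. \<bar>coord (u - x) j\<bar> \<le> \<eta>)"
    then show "(\<forall>j\<in>U. coord (u - t *\<^sub>R unit_czero i) j = coord x j) \<and>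
        (\<forall>j. \<bar>coord (u - t *\<^sub>R unit_czero i - x) j\<bar> \<le> \<eta>)"
      by (auto simp: coord_simps)
  next
    fix u v assume u: "(\<forall>i\<in>{}. coord u i = coord x i) \<and> (\<forall>i. \<bar>coord (u - x) i\<bar> \<le> \<eta>)"
    \<comment> \<open>On the active set the shift contributes \<eta> and the threshold 2 * \<eta>;
      off it the image has coordinate 0 and that of \<open>x\<close> has modulus at most \<eta> /
      2.\<close>
    have "norm (soft_threshold (2 * \<eta>) (restrict_czero ?S u) - x) \<le> 3 * \<eta>"
    proof (rule norm_czero_le)
      fix i
      have "\<bar>coord u i - coord x i\<bar> \<le> \<eta>" using u by (simp add: coord_simps)
      then show "\<bar>coord (soft_threshold (2 * \<eta>) (restrict_czero ?S u) - x) i\<bar> \<le> 3 * \<eta>"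
        using \<eta>_pos by (cases "i \<in> ?S") (auto simp: coord_soft_threshold coord_simps active_def abs_le_iff)
    qed
    then show "norm (truncate f ?S u - c) \<le> B" unfolding truncate_def by (rule B)
  qed (use finite_active f tame_truncate tame_const \<eta>_pos in \<open>auto simp: coord_simps\<close>)
  then show ?thesis using smoothen_eq[OF f finite_active order_refl] by (simp add: mollify_const finite_active)
qed

end

text \<open>Precomposition with the norm-one projection onto \<open>c0 A\<close> extends
  \<open>f\<close> to the whole type without increasing its oscillation. As \<open>B\<close> is
  free, every modulus of continuity of \<open>f\<close> passes on to \<open>F\<close>.\<close>

theorem smooth_approximation:
  fixes f :: "'i czero \<Rightarrow> 'b::banach"
  assumes cont: "continuous_on (c0 A) f"
    and bd: "\<And>R. \<exists>K. \<forall>x\<in>c0 A. norm x \<le> R \<longrightarrow> norm (f x) \<le> K"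
    and "\<eta> > 0"
  obtains F where "F \<in> C_inf (c0 A)"
    and "\<And>x y B. x \<in> c0 A \<Longrightarrow> y \<in> c0 A \<Longrightarrow>
      (\<And>u v. u \<in> c0 A \<Longrightarrow> v \<in> c0 A \<Longrightarrow> norm (u - v) \<le> norm (x - y) \<Longrightarrow> norm (f u - f v) \<le> B) \<Longrightarrow>
      norm (F x - F y) \<le> B"
    and "\<And>x c B. x \<in> c0 A \<Longrightarrow> (\<And>u. u \<in> c0 A \<Longrightarrow> norm (u - x) \<le> 3 * \<eta> \<Longrightarrow> norm (f u - c) \<le> B) \<Longrightarrow>
      norm (F x - c) \<le> B"
proof -
  obtain k where "smoothing_kernel \<eta> k"
    using smooth_kernel[OF \<open>\<eta> > 0\<close>] \<open>\<eta> > 0\<close> unfolding smoothing_kernel_def by metis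
  then interpret smoothing_kernel \<eta> k .
  let ?f = "\<lambda>x. f (restrict_czero A x)"
  have mem: "restrict_czero A x \<in> c0 A" for x by (simp add: c0_def coord_simps)
  have id: "restrict_czero A x = x" if "x \<in> c0 A" for x
    by (rule czero_eqI) (use that in \<open>simp add: c0_def coord_simps\<close>)
  have "1-lipschitz_on UNIV (restrict_czero A)"
    by (rule lipschitz_onI) (auto simp: dist_norm restrict_diff norm_restrict_le)
  then have "continuous_on UNIV ?f"
    by (intro continuous_on_compose2[OF cont] lipschitz_on_continuous_on) (auto simp: mem)
  moreover have "\<exists>K. \<forall>x. norm x \<le> R \<longrightarrow> norm (?f x) \<le> K" for R
  proof -
    obtain K where "\<And>x. x \<in> c0 A \<Longrightarrow> norm x \<le> R \<Longrightarrow> norm (f x) \<le> K" using bd by blast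
    then show ?thesis by (intro exI[of _ K] allI impI) (use mem order_trans[OF norm_restrict_le] in blast)
  qed
  ultimately have f: "tame ?f" unfolding tame_def by blast
  show thesis
  proof
    show "smoothen ?f \<in> C_inf (c0 A)" by (rule C_inf_smoothen[OF f subspace_c0])
    fix x y :: "'i czero" and c B assume x: "x \<in> c0 A"
    show "norm (smoothen ?f x - smoothen ?f y) \<le> B" if "y \<in> c0 A"
      "\<And>u v. u \<in> c0 A \<Longrightarrow> v \<in> c0 A \<Longrightarrow> norm (u - v) \<le> norm (x - y) \<Longrightarrow> norm (f u - f v) \<le> B"
      by (rule norm_smoothen_diff_le[OF f], rule that)
        (auto simp: mem restrict_diff intro: order_trans[OF norm_restrict_le])
    show "norm (smoothen ?f x - c) \<le> B"
      if "\<And>u. u \<in> c0 A \<Longrightarrow> norm (u - x) \<le> 3 * \<eta> \<Longrightarrow> norm (f u - c) \<le> B"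
    proof (rule norm_smoothen_minus_const_le[OF f], rule that)
      fix u assume "norm (u - x) \<le> 3 * \<eta>"
      then show "norm (restrict_czero A u - x) \<le> 3 * \<eta>"
        using norm_restrict_le[of A "u - x"] restrict_diff[of A u x] id[OF x] by simp
    qed (rule mem)
  qed
qed

section \<open>Vanishing oscillation\<close>

lemma tendsto_0_ennreal_iff:
  "((g :: 'a \<Rightarrow> ennreal) \<longlongrightarrow> 0) F \<longleftrightarrow> (\<forall>e>0. \<forall>\<^sub>F x in F. g x \<le> ennreal e)"
proof
  assume g: "(g \<longlongrightarrow> 0) F"
  show "\<forall>e>0. \<forall>\<^sub>F x in F. g x \<le> ennreal e"
  proof (intro allI impI)
    fix e :: real assume "e > 0"
    then have "0 < ennreal e" by simp
    from order_tendstoD(2)[OF g this] show "\<forall>\<^sub>F x in F. g x \<le> ennreal e"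
      by (rule eventually_mono) simp
  qed
next
  assume g: "\<forall>e>0. \<forall>\<^sub>F x in F. g x \<le> ennreal e"
  show "(g \<longlongrightarrow> 0) F"
  proof (rule order_tendstoI)
    fix a :: ennreal assume "0 < a"
    then obtain b where b: "0 < b" "b < a" using dense by blast
    then obtain e where e: "b = ennreal e" "e \<ge> 0" by (cases b) auto
    have "e > 0" using b(1) e by (cases "e = 0") auto
    with g have "\<forall>\<^sub>F x in F. g x \<le> ennreal e" by blast
    then show "\<forall>\<^sub>F x in F. g x < a" by (rule eventually_mono) (use b e in auto)
  qed simp
qed

section \<open>Pointwise forms of the seminorms and vanishing conditions\<close>

locale modulus =
  fixes \<omega> :: "real \<Rightarrow> real"
  assumes \<omega>_pos: "t > 0 \<Longrightarrow> \<omega> t > 0"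
    and \<omega>_mono: "0 < s \<Longrightarrow> s \<le> t \<Longrightarrow> \<omega> s \<le> \<omega> t"
    and \<omega>_tendsto_0: "(\<omega> \<longlongrightarrow> 0) (at_right 0)"
    and \<omega>_at_top: "filterlim \<omega> at_top at_top"
begin

text \<open>The quotient bound with its denominator cleared. It is meant for distinct points: at
  \<open>x = y\<close> it would involve \<open>\<omega> 0\<close>, which is unconstrained.\<close>

abbreviation osc_le :: "real \<Rightarrow> ('a::real_normed_vector \<Rightarrow> 'b::real_normed_vector) \<Rightarrow> 'a \<Rightarrow> 'a \<Rightarrow> bool" where
  "osc_le e f x y \<equiv> norm (f x - f y) \<le> e * \<omega> (norm (x - y))"

lemma osc_pair_le_iff:
  assumes "x \<noteq> y" "e \<ge> 0"
  shows "osc_pair \<omega> f x y \<le> ennreal e \<longleftrightarrow> osc_le e f x y"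
  using \<omega>_pos[of "norm (x - y)"] assms unfolding osc_pair_def
  by (simp add: ennreal_le_iff pos_divide_le_eq)

lemma holder_norm_le_iff:
  assumes "e \<ge> 0"
  shows "holder_norm \<omega> X f \<le> ennreal e \<longleftrightarrow> (\<forall>x\<in>X. \<forall>y\<in>X. x \<noteq> y \<longrightarrow> osc_le e f x y)"
  using osc_pair_le_iff[OF _ assms, of _ _ f] unfolding holder_norm_def by (auto simp: SUP_le_iff)

lemma osc_scale_le_iff:
  assumes "e \<ge> 0" "\<delta> > 0"
  shows "osc_scale \<omega> X f \<delta> \<le> ennreal e \<longleftrightarrow> (\<forall>x\<in>X. \<forall>y\<in>X. norm (x - y) = \<delta> \<longrightarrow> osc_le e f x y)"
proof -
  have "x \<noteq> y" if "norm (x - y) = \<delta>" for x y :: 'a using that assms by auto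
  then show ?thesis
    using osc_pair_le_iff[OF _ assms(1), of _ _ f] unfolding osc_scale_def by (auto simp: SUP_le_iff)
qed

lemma osc_far_le_iff:
  assumes "e \<ge> 0"
  shows "osc_far \<omega> X f \<delta> \<le> ennreal e \<longleftrightarrow>
    (\<forall>x\<in>X. \<forall>y\<in>X. x \<noteq> y \<longrightarrow> norm x > \<delta> \<longrightarrow> norm y > \<delta> \<longrightarrow> osc_le e f x y)"
  using osc_pair_le_iff[OF _ assms, of _ _ f] unfolding osc_far_def by (auto simp: SUP_le_iff)

lemma holder_space_iff:
  "f \<in> holder_space \<omega> X \<longleftrightarrow> (\<exists>L>0. \<forall>x\<in>X. \<forall>y\<in>X. x \<noteq> y \<longrightarrow> osc_le L f x y)"
proof
  assume "f \<in> holder_space \<omega> X"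
  then obtain L where L: "L \<ge> 0" "holder_norm \<omega> X f = ennreal L"
    unfolding holder_space_def by (cases "holder_norm \<omega> X f") auto
  then have "holder_norm \<omega> X f \<le> ennreal (L + 1)" by (simp add: ennreal_leI)
  then show "\<exists>L>0. \<forall>x\<in>X. \<forall>y\<in>X. x \<noteq> y \<longrightarrow> osc_le L f x y"
    using L(1) by (subst (asm) holder_norm_le_iff) (auto intro!: exI[of _ "L + 1"])
next
  assume "\<exists>L>0. \<forall>x\<in>X. \<forall>y\<in>X. x \<noteq> y \<longrightarrow> osc_le L f x y"
  then obtain L where "L > 0" "holder_norm \<omega> X f \<le> ennreal L"
    using holder_norm_le_iff[of _ X f] by (meson less_imp_le)
  then show "f \<in> holder_space \<omega> X"
    unfolding holder_space_def using le_less_trans[OF _ ennreal_less_top] by auto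
qed

lemma VC_small_iff:
  "f \<in> VC_small \<omega> X \<longleftrightarrow> f \<in> holder_space \<omega> X \<and>
    (\<forall>e>0. \<exists>d>0. \<forall>x\<in>X. \<forall>y\<in>X. x \<noteq> y \<longrightarrow> norm (x - y) \<le> d \<longrightarrow> osc_le e f x y)"
proof -
  have "(\<forall>\<^sub>F \<delta> in at_right 0. osc_scale \<omega> X f \<delta> \<le> ennreal e) \<longleftrightarrow>
    (\<exists>d>0. \<forall>x\<in>X. \<forall>y\<in>X. x \<noteq> y \<longrightarrow> norm (x - y) \<le> d \<longrightarrow> osc_le e f x y)" if "e > 0" for e
  proof
    assume "\<forall>\<^sub>F \<delta> in at_right 0. osc_scale \<omega> X f \<delta> \<le> ennreal e"
    then obtain d where d: "d > 0" "\<And>\<delta>. 0 < \<delta> \<Longrightarrow> \<delta> < d \<Longrightarrow> osc_scale \<omega> X f \<delta> \<le> ennreal e"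
      by (auto simp: eventually_at_right_field)
    show "\<exists>d>0. \<forall>x\<in>X. \<forall>y\<in>X. x \<noteq> y \<longrightarrow> norm (x - y) \<le> d \<longrightarrow> osc_le e f x y"
    \<comment> \<open>Halving passes from the strict bound on the scale to a non-strict one.\<close>
    proof (intro exI[of _ "d / 2"] conjI ballI impI)
      fix x y assume "x \<in> X" "y \<in> X" "x \<noteq> y" "norm (x - y) \<le> d / 2"
      then show "osc_le e f x y"
        using d(2)[of "norm (x - y)"] d(1) osc_scale_le_iff[of e "norm (x - y)" X f] that by simp
    qed (use d in simp)
  next
    assume "\<exists>d>0. \<forall>x\<in>X. \<forall>y\<in>X. x \<noteq> y \<longrightarrow> norm (x - y) \<le> d \<longrightarrow> osc_le e f x y"
    then obtain d where d: "d > 0" "\<And>x y. x \<in> X \<Longrightarrow> y \<in> X \<Longrightarrow> x \<noteq> y \<Longrightarrow> norm (x - y) \<le> d \<Longrightarrow> osc_le e f x y"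
      by blast
    have "osc_scale \<omega> X f \<delta> \<le> ennreal e" if "0 < \<delta>" "\<delta> < d" for \<delta>
      using that \<open>e > 0\<close> d by (subst osc_scale_le_iff) auto
    then show "\<forall>\<^sub>F \<delta> in at_right 0. osc_scale \<omega> X f \<delta> \<le> ennreal e"
      using d(1) by (auto simp: eventually_at_right_field)
  qed
  then show ?thesis unfolding VC_small_def tendsto_0_ennreal_iff by auto
qed

lemma VC_large_iff:
  "f \<in> VC_large \<omega> X \<longleftrightarrow> f \<in> holder_space \<omega> X \<and>
    (\<forall>e>0. \<exists>D>0. \<forall>x\<in>X. \<forall>y\<in>X. norm (x - y) \<ge> D \<longrightarrow> osc_le e f x y)"
proof -
  have "(\<forall>\<^sub>F \<delta> in at_top. osc_scale \<omega> X f \<delta> \<le> ennreal e) \<longleftrightarrow>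
    (\<exists>D>0. \<forall>x\<in>X. \<forall>y\<in>X. norm (x - y) \<ge> D \<longrightarrow> osc_le e f x y)" if "e > 0" for e
  proof
    assume "\<forall>\<^sub>F \<delta> in at_top. osc_scale \<omega> X f \<delta> \<le> ennreal e"
    then obtain D where D: "\<And>\<delta>. \<delta> \<ge> D \<Longrightarrow> osc_scale \<omega> X f \<delta> \<le> ennreal e"
      by (auto simp: eventually_at_top_linorder)
    show "\<exists>D>0. \<forall>x\<in>X. \<forall>y\<in>X. norm (x - y) \<ge> D \<longrightarrow> osc_le e f x y"
    \<comment> \<open>The maximum with 1 keeps the scale positive.\<close>
    proof (intro exI[of _ "max D 1"] conjI ballI impI)
      fix x y assume "x \<in> X" "y \<in> X" and t: "norm (x - y) \<ge> max D 1"
      then have "norm (x - y) > 0" "norm (x - y) \<ge> D" by linarith+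
      then show "osc_le e f x y"
        using D[of "norm (x - y)"] osc_scale_le_iff[of e "norm (x - y)" X f] that \<open>x \<in> X\<close> \<open>y \<in> X\<close> by simp
    qed simp
  next
    assume "\<exists>D>0. \<forall>x\<in>X. \<forall>y\<in>X. norm (x - y) \<ge> D \<longrightarrow> osc_le e f x y"
    then obtain D where D: "D > 0" "\<And>x y. x \<in> X \<Longrightarrow> y \<in> X \<Longrightarrow> norm (x - y) \<ge> D \<Longrightarrow> osc_le e f x y"
      by blast
    have "osc_scale \<omega> X f \<delta> \<le> ennreal e" if "\<delta> \<ge> D" for \<delta>
      using that \<open>e > 0\<close> D by (subst osc_scale_le_iff) auto
    then show "\<forall>\<^sub>F \<delta> in at_top. osc_scale \<omega> X f \<delta> \<le> ennreal e"
      by (auto simp: eventually_at_top_linorder)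
  qed
  then show ?thesis unfolding VC_large_def tendsto_0_ennreal_iff by auto
qed

lemma VC_far_iff:
  "f \<in> VC_far \<omega> X \<longleftrightarrow> f \<in> holder_space \<omega> X \<and>
    (\<forall>e>0. \<exists>N>0. \<forall>x\<in>X. \<forall>y\<in>X. x \<noteq> y \<longrightarrow> norm x > N \<longrightarrow> norm y > N \<longrightarrow> osc_le e f x y)"
proof -
  have "(\<forall>\<^sub>F \<delta> in at_top. osc_far \<omega> X f \<delta> \<le> ennreal e) \<longleftrightarrow>
    (\<exists>N>0. \<forall>x\<in>X. \<forall>y\<in>X. x \<noteq> y \<longrightarrow> norm x > N \<longrightarrow> norm y > N \<longrightarrow> osc_le e f x y)" if "e > 0" for e
  proof
    assume "\<forall>\<^sub>F \<delta> in at_top. osc_far \<omega> X f \<delta> \<le> ennreal e"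
    then obtain N where "\<And>\<delta>. \<delta> \<ge> N \<Longrightarrow> osc_far \<omega> X f \<delta> \<le> ennreal e"
      by (auto simp: eventually_at_top_linorder)
    then have "osc_far \<omega> X f (max N 1) \<le> ennreal e" by simp
    then show "\<exists>N>0. \<forall>x\<in>X. \<forall>y\<in>X. x \<noteq> y \<longrightarrow> norm x > N \<longrightarrow> norm y > N \<longrightarrow> osc_le e f x y"
      unfolding osc_far_le_iff[OF less_imp_le[OF that]] by (intro exI[of _ "max N 1"]) simp
  next
    assume "\<exists>N>0. \<forall>x\<in>X. \<forall>y\<in>X. x \<noteq> y \<longrightarrow> norm x > N \<longrightarrow> norm y > N \<longrightarrow> osc_le e f x y"
    then obtain N where N: "\<And>x y. x \<in> X \<Longrightarrow> y \<in> X \<Longrightarrow> x \<noteq> y \<Longrightarrow> norm x > N \<Longrightarrow> norm y > N \<Longrightarrow> osc_le e f x y"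
      by blast
    have "osc_far \<omega> X f \<delta> \<le> ennreal e" if "\<delta> \<ge> N" for \<delta>
      using that \<open>e > 0\<close> N by (subst osc_far_le_iff) auto
    then show "\<forall>\<^sub>F \<delta> in at_top. osc_far \<omega> X f \<delta> \<le> ennreal e"
      by (auto simp: eventually_at_top_linorder)
  qed
  then show ?thesis unfolding VC_far_def tendsto_0_ennreal_iff by auto
qed

lemma VC_smallE:
  assumes "f \<in> VC_small \<omega> X" "e > 0"
  obtains d where "d > 0" "\<And>x y. x \<in> X \<Longrightarrow> y \<in> X \<Longrightarrow> x \<noteq> y \<Longrightarrow> norm (x - y) \<le> d \<Longrightarrow> osc_le e f x y"
  using assms VC_small_iff[of f X] by metis

lemma VC_largeE:
  assumes "f \<in> VC_large \<omega> X" "e > 0"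
  obtains D where "D > 0" "\<And>x y. x \<in> X \<Longrightarrow> y \<in> X \<Longrightarrow> norm (x - y) \<ge> D \<Longrightarrow> osc_le e f x y"
  using assms VC_large_iff[of f X] by metis

lemma VC_farE:
  assumes "f \<in> VC_far \<omega> X" "e > 0"
  obtains N where "N > 0"
    "\<And>x y. x \<in> X \<Longrightarrow> y \<in> X \<Longrightarrow> x \<noteq> y \<Longrightarrow> norm x > N \<Longrightarrow> norm y > N \<Longrightarrow> osc_le e f x y"
  using assms VC_far_iff[of f X] by metis

lemma holder_spaceE:
  assumes "f \<in> holder_space \<omega> X"
  obtains L where "L > 0" "\<And>x y. x \<in> X \<Longrightarrow> y \<in> X \<Longrightarrow> x \<noteq> y \<Longrightarrow> osc_le L f x y"
  using assms holder_space_iff[of f X] by metis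

lemma holder_closure_iff:
  "f \<in> holder_closure \<omega> X C \<longleftrightarrow> f \<in> holder_space \<omega> X \<and>
    (\<forall>e>0. \<exists>F\<in>C. \<forall>x\<in>X. \<forall>y\<in>X. x \<noteq> y \<longrightarrow> osc_le e (\<lambda>x. F x - f x) x y)"
proof -
  have "(\<exists>F :: nat \<Rightarrow> 'a \<Rightarrow> 'b. (\<forall>n. F n \<in> C) \<and> (\<lambda>n. holder_norm \<omega> X (\<lambda>x. F n x - f x)) \<longlonglongrightarrow> 0) \<longleftrightarrow>
    (\<forall>e>0. \<exists>F\<in>C. holder_norm \<omega> X (\<lambda>x. F x - f x) \<le> ennreal e)"
  proof
    assume "\<forall>e>0. \<exists>F\<in>C. holder_norm \<omega> X (\<lambda>x. F x - f x) \<le> ennreal e"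
    then have "\<forall>n. \<exists>F\<in>C. holder_norm \<omega> X (\<lambda>x. F x - f x) \<le> ennreal (inverse (real (Suc n)))"
      by simp
    then obtain F where F: "\<And>n. F n \<in> C"
        "\<And>n. holder_norm \<omega> X (\<lambda>x. F n x - f x) \<le> ennreal (inverse (real (Suc n)))"
      by metis
    have "(\<lambda>n. holder_norm \<omega> X (\<lambda>x. F n x - f x)) \<longlonglongrightarrow> 0"
      unfolding tendsto_0_ennreal_iff
    proof (intro allI impI)
      fix e :: real assume "e > 0"
      then have "\<forall>\<^sub>F n in sequentially. inverse (real (Suc n)) < e"
        using LIMSEQ_inverse_real_of_nat order_tendstoD(2) by blast
      then show "\<forall>\<^sub>F n in sequentially. holder_norm \<omega> X (\<lambda>x. F n x - f x) \<le> ennreal e"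
        by (rule eventually_mono) (use order_trans[OF F(2) ennreal_leI] in auto)
    qed
    with F show "\<exists>F :: nat \<Rightarrow> 'a \<Rightarrow> 'b. (\<forall>n. F n \<in> C) \<and> (\<lambda>n. holder_norm \<omega> X (\<lambda>x. F n x - f x)) \<longlonglongrightarrow> 0" by blast
  next
    assume "\<exists>F :: nat \<Rightarrow> 'a \<Rightarrow> 'b. (\<forall>n. F n \<in> C) \<and> (\<lambda>n. holder_norm \<omega> X (\<lambda>x. F n x - f x)) \<longlonglongrightarrow> 0"
    then show "\<forall>e>0. \<exists>F\<in>C. holder_norm \<omega> X (\<lambda>x. F x - f x) \<le> ennreal e"
      unfolding tendsto_0_ennreal_iff eventually_sequentially by blast
  qed
  then show ?thesis unfolding holder_closure_def using holder_norm_le_iff[of _ X "\<lambda>x. _ x - f x"]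
    by (auto simp: less_imp_le)
qed

section \<open>Closedness of the vanishing spaces\<close>

lemma osc_le_perturb:
  assumes "osc_le (e / 2) F x y" "osc_le (e / 2) (\<lambda>x. F x - f x) x y"
  shows "osc_le e f x y"
proof -
  have "f x - f y = (F x - F y) - ((F x - f x) - (F y - f y))" by simp
  then have "norm (f x - f y) \<le> norm (F x - F y) + norm ((F x - f x) - (F y - f y))"
    using norm_triangle_ineq4 by metis
  then show ?thesis using assms by simp
qed

lemma holder_closure_subset_VC_small:
  assumes "C \<subseteq> VC_small \<omega> X"
  shows "holder_closure \<omega> X C \<subseteq> VC_small \<omega> X"
proof
  fix f assume f: "f \<in> holder_closure \<omega> X C"
  show "f \<in> VC_small \<omega> X"
    unfolding VC_small_iff
  proof (intro conjI allI impI)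
    show "f \<in> holder_space \<omega> X" using f by (simp add: holder_closure_def)
    fix e :: real assume "e > 0"
    then have e: "e / 2 > 0" by simp
    obtain F where F: "F \<in> VC_small \<omega> X" "\<And>x y. x \<in> X \<Longrightarrow> y \<in> X \<Longrightarrow> x \<noteq> y \<Longrightarrow> osc_le (e / 2) (\<lambda>x. F x - f x) x y"
      using f e assms unfolding holder_closure_iff by blast
    obtain d where d: "d > 0" "\<And>x y. x \<in> X \<Longrightarrow> y \<in> X \<Longrightarrow> x \<noteq> y \<Longrightarrow> norm (x - y) \<le> d \<Longrightarrow> osc_le (e / 2) F x y"
      by (rule VC_smallE[OF F(1) e]) blast
    show "\<exists>d>0. \<forall>x\<in>X. \<forall>y\<in>X. x \<noteq> y \<longrightarrow> norm (x - y) \<le> d \<longrightarrow> osc_le e f x y"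
    proof (intro exI[of _ d] conjI ballI impI d(1))
      fix x y assume "x \<in> X" "y \<in> X" "x \<noteq> y" "norm (x - y) \<le> d"
      then show "osc_le e f x y" using osc_le_perturb[OF d(2)[of x y] F(2)[of x y]] by simp
    qed
  qed
qed

lemma holder_closure_subset_VC:
  assumes "C \<subseteq> VC \<omega> X"
  shows "holder_closure \<omega> X C \<subseteq> VC \<omega> X"
proof
  fix f assume f: "f \<in> holder_closure \<omega> X C"
  then have fX: "f \<in> holder_space \<omega> X" by (simp add: holder_closure_def)
  have approx: "\<exists>F\<in>VC \<omega> X. \<forall>x\<in>X. \<forall>y\<in>X. x \<noteq> y \<longrightarrow> osc_le (e / 2) (\<lambda>x. F x - f x) x y" if "e > 0" for e
  proof -
    have "e / 2 > 0" using that by simp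
    then show ?thesis using f assms unfolding holder_closure_iff by blast
  qed
  have "f \<in> VC_small \<omega> X"
    using f assms holder_closure_subset_VC_small[of C X] by (auto simp: VC_def)
  moreover have "f \<in> VC_large \<omega> X"
    unfolding VC_large_iff
  proof (intro conjI allI impI fX)
    fix e :: real assume "e > 0"
    then have e: "e / 2 > 0" by simp
    obtain F where F: "F \<in> VC_large \<omega> X" "\<And>x y. x \<in> X \<Longrightarrow> y \<in> X \<Longrightarrow> x \<noteq> y \<Longrightarrow> osc_le (e / 2) (\<lambda>x. F x - f x) x y"
      using approx[OF \<open>e > 0\<close>] unfolding VC_def by blast
    obtain D where D: "D > 0" "\<And>x y. x \<in> X \<Longrightarrow> y \<in> X \<Longrightarrow> norm (x - y) \<ge> D \<Longrightarrow> osc_le (e / 2) F x y"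
      by (rule VC_largeE[OF F(1) e]) blast
    have neq: "x \<noteq> y" if "norm (x - y) \<ge> D" for x y :: 'a using that D(1) by auto
    show "\<exists>D>0. \<forall>x\<in>X. \<forall>y\<in>X. norm (x - y) \<ge> D \<longrightarrow> osc_le e f x y"
    proof (intro exI[of _ D] conjI ballI impI D(1))
      fix x y assume "x \<in> X" "y \<in> X" "norm (x - y) \<ge> D"
      then show "osc_le e f x y" using osc_le_perturb[OF D(2)[of x y] F(2)[of x y]] neq by simp
    qed
  qed
  moreover have "f \<in> VC_far \<omega> X"
    unfolding VC_far_iff
  proof (intro conjI allI impI fX)
    fix e :: real assume "e > 0"
    then have e: "e / 2 > 0" by simp
    obtain F where F: "F \<in> VC_far \<omega> X" "\<And>x y. x \<in> X \<Longrightarrow> y \<in> X \<Longrightarrow> x \<noteq> y \<Longrightarrow> osc_le (e / 2) (\<lambda>x. F x - f x) x y"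
      using approx[OF \<open>e > 0\<close>] unfolding VC_def by blast
    obtain N where N: "N > 0" "\<And>x y. x \<in> X \<Longrightarrow> y \<in> X \<Longrightarrow> x \<noteq> y \<Longrightarrow> norm x > N \<Longrightarrow> norm y > N \<Longrightarrow> osc_le (e / 2) F x y"
      by (rule VC_farE[OF F(1) e]) blast
    show "\<exists>N>0. \<forall>x\<in>X. \<forall>y\<in>X. x \<noteq> y \<longrightarrow> norm x > N \<longrightarrow> norm y > N \<longrightarrow> osc_le e f x y"
    proof (intro exI[of _ N] conjI ballI impI N(1))
      fix x y assume "x \<in> X" "y \<in> X" "x \<noteq> y" "norm x > N" "norm y > N"
      then show "osc_le e f x y" using osc_le_perturb[OF N(2)[of x y] F(2)[of x y]] by simp
    qed
  qed
  ultimately show "f \<in> VC \<omega> X" by (simp add: VC_def)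
qed

text \<open>Monotonicity of \<omega> carries an oscillation bound to any larger scale
  \<open>t\<close>. Equal points are treated apart, since \<open>\<omega> 0\<close> is
  unknown.\<close>

lemma osc_le_mono:
  assumes "u \<noteq> v \<Longrightarrow> osc_le e f u v" "norm (u - v) \<le> t" "t > 0" "e \<ge> 0"
  shows "norm (f u - f v) \<le> e * \<omega> t"
proof (cases "u = v")
  case True
  then show ?thesis using assms \<omega>_pos[of t] by simp
next
  case False
  then have "e * \<omega> (norm (u - v)) \<le> e * \<omega> t" using assms by (intro mult_left_mono \<omega>_mono) auto
  with assms(1)[OF False] show ?thesis by simp
qed

lemma holder_space_bounded_on_balls:
  assumes "f \<in> holder_space \<omega> X" "0 \<in> X"
  obtains K where "\<And>x. x \<in> X \<Longrightarrow> norm x \<le> R \<Longrightarrow> norm (f x) \<le> K"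
proof -
  obtain L where L: "L > 0" "\<And>x y. x \<in> X \<Longrightarrow> y \<in> X \<Longrightarrow> x \<noteq> y \<Longrightarrow> osc_le L f x y"
    by (rule holder_spaceE[OF assms(1)]) blast
  \<comment> \<open>The maximum keeps the comparison scale positive even if \<open>R\<close> is
    not.\<close>
  have "norm (f x) \<le> norm (f 0) + L * \<omega> (max R 1)" if "x \<in> X" "norm x \<le> R" for x
  proof -
    have "norm (f x - f 0) \<le> L * \<omega> (max R 1)"
      by (rule osc_le_mono[of x 0]) (use L(1) L(2)[of x 0] that assms(2) in auto)
    then show ?thesis using norm_triangle_ineq2[of "f x" "f 0"] by linarith
  qed
  then show thesis by (rule that)
qed

lemma holder_space_continuous_on:
  assumes "f \<in> holder_space \<omega> X"
  shows "continuous_on X f"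
  unfolding continuous_on_iff dist_norm
proof (intro ballI allI impI)
  fix x :: 'a and e :: real assume x: "x \<in> X" and e: "e > 0"
  obtain L where L: "L > 0" "\<And>x y. x \<in> X \<Longrightarrow> y \<in> X \<Longrightarrow> x \<noteq> y \<Longrightarrow> osc_le L f x y"
    by (rule holder_spaceE[OF assms]) blast
  have "e / L > 0" using L(1) e by simp
  from order_tendstoD(2)[OF \<omega>_tendsto_0 this]
  obtain d where d: "d > 0" "\<And>t. 0 < t \<Longrightarrow> t < d \<Longrightarrow> \<omega> t < e / L"
    by (auto simp: eventually_at_right_field)
  show "\<exists>d>0. \<forall>y\<in>X. norm (y - x) < d \<longrightarrow> norm (f y - f x) < e"
  proof (intro exI[of _ d] conjI ballI impI d(1))
    fix y assume y: "y \<in> X" "norm (y - x) < d"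
    show "norm (f y - f x) < e"
    proof (cases "y = x")
      case False
      then have "L * \<omega> (norm (y - x)) < e"
        using d(2)[of "norm (y - x)"] y L(1) by (simp add: pos_less_divide_eq mult.commute)
      then show ?thesis using L(2)[OF y(1) x False] by linarith
    qed (use e in simp)
  qed
qed

text \<open>\<open>F\<close> is bounded by its bound on the ball of radius \<open>R\<close>, so the
  divergence of \<omega> handles large scales; beyond \<open>R\<close> all values are equal.\<close>

lemma VC_bounded_support:
  assumes F: "F \<in> VC_small \<omega> X" and "0 \<in> X" "R > 0"
    and supp: "\<And>x. x \<in> X \<Longrightarrow> norm x \<ge> R \<Longrightarrow> F x = 0"
  shows "F \<in> VC \<omega> X"
proof -
  have FX: "F \<in> holder_space \<omega> X" using F by (simp add: VC_small_def)
  obtain K where K: "\<And>x. x \<in> X \<Longrightarrow> norm x \<le> R \<Longrightarrow> norm (F x) \<le> K"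
    by (rule holder_space_bounded_on_balls[OF FX \<open>0 \<in> X\<close>]) blast
  have K0: "K \<ge> 0" using order_trans[OF norm_ge_zero K[OF \<open>0 \<in> X\<close>]] \<open>R > 0\<close> by simp
  have bd: "norm (F x) \<le> K" if "x \<in> X" for x
    using K[OF that] supp[OF that] K0 by (cases "norm x \<le> R") auto
  have "F \<in> VC_large \<omega> X"
    unfolding VC_large_iff
  proof (intro conjI allI impI FX)
    fix e :: real assume e: "e > 0"
    have "\<forall>\<^sub>F t in at_top. \<omega> t \<ge> 2 * K / e" using \<omega>_at_top by (simp add: filterlim_at_top)
    then obtain D where D: "\<And>t. t \<ge> D \<Longrightarrow> \<omega> t \<ge> 2 * K / e" by (auto simp: eventually_at_top_linorder)
    show "\<exists>D>0. \<forall>x\<in>X. \<forall>y\<in>X. norm (x - y) \<ge> D \<longrightarrow> osc_le e F x y"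
    proof (intro exI[of _ "max D 1"] conjI ballI impI)
      fix x y assume xy: "x \<in> X" "y \<in> X" "norm (x - y) \<ge> max D 1"
      have "norm (F x - F y) \<le> 2 * K"
        using norm_triangle_ineq4[of "F x" "F y"] bd[OF xy(1)] bd[OF xy(2)] by linarith
      also have "\<dots> \<le> e * \<omega> (norm (x - y))"
        using D[of "norm (x - y)"] xy(3) e by (simp add: pos_divide_le_eq mult.commute)
      finally show "osc_le e F x y" .
    qed simp
  qed
  moreover have "F \<in> VC_far \<omega> X"
    unfolding VC_far_iff
  proof (intro conjI allI impI FX)
    fix e :: real assume e: "e > 0"
    show "\<exists>N>0. \<forall>x\<in>X. \<forall>y\<in>X. x \<noteq> y \<longrightarrow> norm x > N \<longrightarrow> norm y > N \<longrightarrow> osc_le e F x y"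
    proof (intro exI[of _ R] conjI ballI impI \<open>R > 0\<close>)
      fix x y assume "x \<in> X" "y \<in> X" "x \<noteq> y" "norm x > R" "norm y > R"
      then show "osc_le e F x y" using supp[of x] supp[of y] e \<omega>_pos[of "norm (x - y)"] by simp
    qed
  qed
  ultimately show ?thesis using F by (simp add: VC_def)
qed

text \<open>Pairs at distance at most \<open>d\<close> are estimated through \<open>F\<close> and
  \<open>f\<close> separately, as both oscillate little there; pairs further apart through the size
  of F - f at each point. The last conclusion says that smoothing is local, which later keeps
  supports bounded.\<close>

lemma VC_small_smooth_approximation:
  fixes f :: "'i czero \<Rightarrow> 'b::banach"
  assumes f: "f \<in> VC_small \<omega> (c0 A)" and "e > 0" "r > 0"
  obtains F where "F \<in> C_inf (c0 A)" "F \<in> VC_small \<omega> (c0 A)"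
    "\<And>x y. x \<in> c0 A \<Longrightarrow> y \<in> c0 A \<Longrightarrow> x \<noteq> y \<Longrightarrow> osc_le e (\<lambda>x. F x - f x) x y"
    "\<And>x c. x \<in> c0 A \<Longrightarrow> (\<And>u. u \<in> c0 A \<Longrightarrow> norm (u - x) \<le> r \<Longrightarrow> f u = c) \<Longrightarrow> F x = c"
proof -
  let ?X = "c0 A :: 'i czero set"
  have fX: "f \<in> holder_space \<omega> ?X" using f by (simp add: VC_small_def)
  have "e / 2 > 0" using \<open>e > 0\<close> by simp
  then obtain d where d: "d > 0"
      "\<And>x y. x \<in> ?X \<Longrightarrow> y \<in> ?X \<Longrightarrow> x \<noteq> y \<Longrightarrow> norm (x - y) \<le> d \<Longrightarrow> osc_le (e / 2) f x y"
    by (rule VC_smallE[OF f]) blast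
  \<comment> \<open>Smoothing looks as far as 3 * \<eta>, which has to stay within both
    \<open>d\<close> and \<open>r\<close>.\<close>
  define \<eta> where "\<eta> = min d r / 3"
  have \<eta>: "\<eta> > 0" "3 * \<eta> \<le> d" "3 * \<eta> \<le> r" using d(1) \<open>r > 0\<close> by (auto simp: \<eta>_def)
  have bd: "\<exists>K. \<forall>x\<in>?X. norm x \<le> R \<longrightarrow> norm (f x) \<le> K" for R
    by (rule holder_space_bounded_on_balls[OF fX subspace_0[OF subspace_c0], of R]) blast
  show thesis
  proof (rule smooth_approximation[OF holder_space_continuous_on[OF fX] bd \<eta>(1)])
    fix F assume F: "F \<in> C_inf ?X"
      and diff: "\<And>x y B. x \<in> ?X \<Longrightarrow> y \<in> ?X \<Longrightarrow>
        (\<And>u v. u \<in> ?X \<Longrightarrow> v \<in> ?X \<Longrightarrow> norm (u - v) \<le> norm (x - y) \<Longrightarrow> norm (f u - f v) \<le> B) \<Longrightarrow>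
        norm (F x - F y) \<le> B"
      and near: "\<And>x c B. x \<in> ?X \<Longrightarrow> (\<And>u. u \<in> ?X \<Longrightarrow> norm (u - x) \<le> 3 * \<eta> \<Longrightarrow> norm (f u - c) \<le> B) \<Longrightarrow>
        norm (F x - c) \<le> B"
    have osc: "osc_le a F x y" if "x \<in> ?X" "y \<in> ?X" "x \<noteq> y" "a > 0"
      and a: "\<And>u v. u \<in> ?X \<Longrightarrow> v \<in> ?X \<Longrightarrow> u \<noteq> v \<Longrightarrow> norm (u - v) \<le> norm (x - y) \<Longrightarrow> osc_le a f u v" for a x y
    proof (rule diff[OF that(1,2)])
      fix u v assume uv: "u \<in> ?X" "v \<in> ?X" "norm (u - v) \<le> norm (x - y)"
      show "norm (f u - f v) \<le> a * \<omega> (norm (x - y))"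
        by (rule osc_le_mono[of u v]) (use uv a that(3,4) in auto)
    qed
    have FX: "F \<in> holder_space \<omega> ?X"
    proof (rule holder_spaceE[OF fX])
      fix L assume L: "L > 0" "\<And>x y. x \<in> ?X \<Longrightarrow> y \<in> ?X \<Longrightarrow> x \<noteq> y \<Longrightarrow> osc_le L f x y"
      show ?thesis unfolding holder_space_iff by (intro exI[of _ L] conjI ballI impI osc L)
    qed
    show thesis
    proof (rule that)
      show "F \<in> C_inf ?X" by fact
      show "F \<in> VC_small \<omega> ?X"
        unfolding VC_small_iff
      proof (intro conjI allI impI FX)
        fix a :: real assume "a > 0"
        then obtain d where "d > 0"
            "\<And>x y. x \<in> ?X \<Longrightarrow> y \<in> ?X \<Longrightarrow> x \<noteq> y \<Longrightarrow> norm (x - y) \<le> d \<Longrightarrow> osc_le a f x y"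
          by (rule VC_smallE[OF f]) blast
        then show "\<exists>d>0. \<forall>x\<in>?X. \<forall>y\<in>?X. x \<noteq> y \<longrightarrow> norm (x - y) \<le> d \<longrightarrow> osc_le a F x y"
          using \<open>a > 0\<close> by (intro exI[of _ d] conjI ballI impI osc) auto
      qed
      show "osc_le e (\<lambda>x. F x - f x) x y" if xy: "x \<in> ?X" "y \<in> ?X" "x \<noteq> y" for x y
      proof (cases "norm (x - y) \<le> d")
        case True
        have "osc_le (e / 2) F x y" by (rule osc) (use xy True d \<open>e > 0\<close> in auto)
        moreover have "osc_le (e / 2) f x y" by (rule d(2)[OF xy True])
        moreover have "norm ((F x - f x) - (F y - f y)) \<le> norm (F x - F y) + norm (f x - f y)"
          using norm_triangle_ineq4[of "F x - F y" "f x - f y"] by (simp add: algebra_simps)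
        ultimately show ?thesis by simp
      next
        case False
        \<comment> \<open>The points \<open>u\<close> that matter satisfy norm (u - z) \<le> 3 *
          \<eta> \<le> d < norm (x - y), so small-scale oscillation and monotonicity of \<omega>
          give the bound.\<close>
        have close: "norm (F z - f z) \<le> e / 2 * \<omega> (norm (x - y))" if "z \<in> ?X" for z
        proof (rule near[OF that])
          fix u assume u: "u \<in> ?X" "norm (u - z) \<le> 3 * \<eta>"
          show "norm (f u - f z) \<le> e / 2 * \<omega> (norm (x - y))"
            by (rule osc_le_mono[of u z]) (use u that \<eta> d False \<open>e > 0\<close> xy in auto)
        qed
        show ?thesis
          using norm_triangle_ineq4[of "F x - f x" "F y - f y"] close[OF xy(1)] close[OF xy(2)] by simp
      qed
      show "F x = c" if "x \<in> ?X" "\<And>u. u \<in> ?X \<Longrightarrow> norm (u - x) \<le> r \<Longrightarrow> f u = c" for x c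
        using near[OF that(1), of c 0] that(2) \<eta>(3) by simp
    qed
  qed
qed

lemma holder_closure_C_inf_VC_small:
  "holder_closure \<omega> (c0 A) (C_inf (c0 A) \<inter> VC_small \<omega> (c0 A))
     = (VC_small \<omega> (c0 A) :: ('i czero \<Rightarrow> 'b::banach) set)"
proof
  show "VC_small \<omega> (c0 A) \<subseteq> holder_closure \<omega> (c0 A) (C_inf (c0 A) \<inter> (VC_small \<omega> (c0 A) :: ('i czero \<Rightarrow> 'b) set))"
  proof
    fix f :: "'i czero \<Rightarrow> 'b" assume f: "f \<in> VC_small \<omega> (c0 A)"
    show "f \<in> holder_closure \<omega> (c0 A) (C_inf (c0 A) \<inter> VC_small \<omega> (c0 A))"
      unfolding holder_closure_iff
    proof (intro conjI allI impI)
      show "f \<in> holder_space \<omega> (c0 A)" using f by (simp add: VC_small_def)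
      fix e :: real assume "e > 0"
      from VC_small_smooth_approximation[OF f this zero_less_one]
      show "\<exists>F\<in>C_inf (c0 A) \<inter> VC_small \<omega> (c0 A). \<forall>x\<in>c0 A. \<forall>y\<in>c0 A. x \<noteq> y \<longrightarrow> osc_le e (\<lambda>x. F x - f x) x y"
        by (metis IntI)
    qed
  qed
qed (intro holder_closure_subset_VC_small, simp)

end

section \<open>Approximation by maps of bounded support\<close>

text \<open>
  The minimum and the maximum splice three branches: the identity up to \<open>R\<close>, then slope
  \<open>- s\<close> down to 0, then 0.
\<close>

definition shrink_radius :: "real \<Rightarrow> real \<Rightarrow> real \<Rightarrow> real" where
  "shrink_radius R s r = min r (max 0 ((1 + s) * R - s * r))"

definition radial_shrink :: "real \<Rightarrow> real \<Rightarrow> 'a::real_normed_vector \<Rightarrow> 'a" where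
  "radial_shrink R s x = (shrink_radius R s (norm x) / norm x) *\<^sub>R x"

lemma shrink_radius_nonneg: "r \<ge> 0 \<Longrightarrow> shrink_radius R s r \<ge> 0"
  and shrink_radius_le: "shrink_radius R s r \<le> r"
  by (auto simp: shrink_radius_def)

lemma shrink_radius_0: "shrink_radius R s 0 = 0"
  by (simp add: antisym shrink_radius_le shrink_radius_nonneg)

text \<open>At \<open>R\<close> the identity meets the line of slope - s; before it the identity is
  the smaller of the two, after it the line is, also once cut off at 0.\<close>

lemma shrink_radius_eq:
  assumes "s \<ge> 0"
  shows "r \<le> R \<Longrightarrow> r \<ge> 0 \<Longrightarrow> shrink_radius R s r = r"
    and "r \<ge> R \<Longrightarrow> R \<ge> 0 \<Longrightarrow> shrink_radius R s r = max 0 ((1 + s) * R - s * r)"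
proof -
  show "shrink_radius R s r = r" if "r \<le> R" "r \<ge> 0"
    using mult_left_mono[OF that(1) assms] that by (simp add: shrink_radius_def algebra_simps)
  show "shrink_radius R s r = max 0 ((1 + s) * R - s * r)" if "r \<ge> R" "R \<ge> 0"
    using mult_left_mono[OF that(1) assms] that by (simp add: shrink_radius_def algebra_simps)
qed

lemma shrink_radius_lipschitz:
  assumes "0 \<le> s" "s \<le> 1"
  shows "\<bar>shrink_radius R s a - shrink_radius R s b\<bar> \<le> \<bar>a - b\<bar>"
proof -
  let ?p = "\<lambda>r. (1 + s) * R - s * r"
  have "?p b - ?p a = s * (a - b)" by (simp add: algebra_simps)
  then have "\<bar>?p b - ?p a\<bar> = s * \<bar>a - b\<bar>" using assms by (simp add: abs_mult)
  also have "\<dots> \<le> 1 * \<bar>a - b\<bar>" using assms by (intro mult_right_mono) auto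
  finally have "\<bar>?p b - ?p a\<bar> \<le> \<bar>a - b\<bar>" by simp
  moreover have "\<bar>min a (max 0 p) - min b (max 0 q)\<bar> \<le> \<bar>a - b\<bar>" if "\<bar>q - p\<bar> \<le> \<bar>a - b\<bar>" for p q
    using that by (auto simp: min_def max_def abs_if split: if_splits)
  ultimately show ?thesis unfolding shrink_radius_def by blast
qed

lemma norm_radial_shrink: "norm (radial_shrink R s x) = shrink_radius R s (norm x)"
  by (cases "x = 0") (simp_all add: radial_shrink_def shrink_radius_nonneg shrink_radius_0)

text \<open>The difference is split into a multiple of \<open>x - y\<close> and a multiple of
  \<open>y\<close>. The ratio of radii at \<open>x\<close> is kept explicit rather than bounded by
  1: it is small where the image is near the origin and \<open>x\<close> is far out, which yields
  contraction.\<close>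

lemma radial_shrink_diff_le:
  "norm (radial_shrink R s x - radial_shrink R s y)
     \<le> 2 * (shrink_radius R s (norm x) / norm x) * norm (x - y)
       + \<bar>shrink_radius R s (norm x) - shrink_radius R s (norm y)\<bar>"
proof -
  let ?a = "shrink_radius R s (norm x) / norm x" and ?b = "shrink_radius R s (norm y) / norm y"
  have a: "?a \<ge> 0" by (simp add: shrink_radius_nonneg)
  have eq: "shrink_radius R s (norm z) / norm z * norm z = shrink_radius R s (norm z)" for z :: 'a
    by (cases "z = 0") (simp_all add: shrink_radius_0)
  have "radial_shrink R s x - radial_shrink R s y = ?a *\<^sub>R (x - y) + (?a - ?b) *\<^sub>R y"
    by (simp add: radial_shrink_def algebra_simps)
  also have "norm \<dots> \<le> ?a * norm (x - y) + \<bar>?a - ?b\<bar> * norm y"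
    using norm_triangle_ineq[of "?a *\<^sub>R (x - y)" "(?a - ?b) *\<^sub>R y"] a by (simp only: norm_scaleR abs_of_nonneg[OF a])
  also have "\<bar>?a - ?b\<bar> * norm y = \<bar>(?a - ?b) * norm y\<bar>" by (simp only: abs_mult abs_norm_cancel)
  also have "(?a - ?b) * norm y = ?a * (norm y - norm x) + (shrink_radius R s (norm x) - shrink_radius R s (norm y))"
    using eq[of x] eq[of y] by (simp only: left_diff_distrib right_diff_distrib)
  also have "\<bar>\<dots>\<bar> \<le> \<bar>?a * (norm y - norm x)\<bar> + \<bar>shrink_radius R s (norm x) - shrink_radius R s (norm y)\<bar>"
    by (rule abs_triangle_ineq)
  also have "\<bar>?a * (norm y - norm x)\<bar> \<le> ?a * norm (x - y)"
    unfolding abs_mult abs_of_nonneg[OF a]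
    using norm_triangle_ineq3[of y x] by (intro mult_left_mono a) (simp add: norm_minus_commute)
  finally show ?thesis by (simp add: algebra_simps)
qed

text \<open>The ratio of radii is at most 1 and the radial profile is 1-Lipschitz, so the constant
  is 2 + 1.\<close>

lemma radial_shrink_lipschitz:
  assumes "0 \<le> s" "s \<le> 1"
  shows "norm (radial_shrink R s x - radial_shrink R s y) \<le> 3 * norm (x - y)"
proof -
  have "shrink_radius R s (norm x) / norm x \<le> 1"
    using shrink_radius_le[of R s "norm x"] by (simp add: divide_le_eq_1)
  then have "2 * (shrink_radius R s (norm x) / norm x) * norm (x - y) \<le> 2 * 1 * norm (x - y)"
    by (intro mult_right_mono mult_left_mono) auto
  moreover have "\<bar>shrink_radius R s (norm x) - shrink_radius R s (norm y)\<bar> \<le> norm (x - y)"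
    using shrink_radius_lipschitz[OF assms, of R "norm x" "norm y"] norm_triangle_ineq3[of x y] by linarith
  ultimately show ?thesis using radial_shrink_diff_le[of R s x y] by linarith
qed

lemma radial_shrink_eq:
  assumes "s \<ge> 0" "norm x \<le> R"
  shows "radial_shrink R s x = x"
  using shrink_radius_eq(1)[OF assms(1,2)] by (simp add: radial_shrink_def)

text \<open>As \<open>x\<close> lies outside radius \<open>N\<close> but its image does not, the
  profile has fallen from \<open>R\<close> to at most \<open>N\<close>. With a descent of slope at
  most 1 this takes a distance of at least R - N \<ge> T, so \<open>y\<close> too lies beyond
  \<open>R\<close>, where the profile is \<open>s\<close>-Lipschitz. The ratio of radii at
  \<open>x\<close> is at most N / R.\<close>

lemma radial_shrink_contraction:
  assumes s: "0 < s" "s \<le> 1" and N: "N \<ge> 0" "N < norm x" "norm (radial_shrink R s x) \<le> N"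
    and R: "R \<ge> N + T" "R > 0" and xy: "norm (x - y) \<le> T"
  shows "norm (radial_shrink R s x - radial_shrink R s y) \<le> 2 * (N / R) * T + s * T"
proof -
  let ?\<phi> = "shrink_radius R s"
  have T: "T \<ge> 0" using xy norm_ge_zero order_trans by blast
  have phi: "?\<phi> (norm x) \<le> N" using N(3) by (simp add: norm_radial_shrink)
  have xR: "norm x > R"
    using shrink_radius_eq(1)[of s "norm x" R] s N(2) phi by (metis leI less_imp_le norm_ge_zero not_less)
  then have "max 0 ((1 + s) * R - s * norm x) \<le> N"
    using shrink_radius_eq(2)[of s R "norm x"] s R phi by simp
  then have "s * (norm x - R) \<ge> R - N" by (simp add: algebra_simps)
  moreover have "s * (norm x - R) \<le> 1 * (norm x - R)" using s xR by (intro mult_right_mono) auto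
  ultimately have "R - N \<le> 1 * (norm x - R)" by (rule order_trans)
  then have "norm x \<ge> R + T" using R(1) by (simp add: algebra_simps)
  then have yR: "norm y \<ge> R" using norm_triangle_ineq2[of x y] xy by linarith
  have "\<bar>?\<phi> (norm x) - ?\<phi> (norm y)\<bar> \<le> \<bar>s * (norm x - norm y)\<bar>"
    using shrink_radius_eq(2)[of s R "norm x"] shrink_radius_eq(2)[of s R "norm y"] s R xR yR
    by (simp add: right_diff_distrib)
  also have "\<dots> \<le> s * T"
    unfolding abs_mult using s norm_triangle_ineq3[of x y] xy by (simp add: mult_left_mono)
  finally have 1: "\<bar>?\<phi> (norm x) - ?\<phi> (norm y)\<bar> \<le> s * T" .
  have "?\<phi> (norm x) / norm x \<le> N / R"
    using xR R(2) N(1) phi by (intro frac_le) auto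
  then have "2 * (?\<phi> (norm x) / norm x) * norm (x - y) \<le> 2 * (N / R) * T"
    using xy T N(1) R(2) by (intro mult_mono) (auto simp: shrink_radius_nonneg)
  with 1 show ?thesis using radial_shrink_diff_le[of R s x y] by linarith
qed

section \<open>Cutting off the support at small cost in the seminorm\<close>

context modulus
begin

text \<open>The scale is 3 * norm (x - y) because the images may be three times as far apart;
  \<open>f\<close> and its composition with the radial map contribute one \<open>e\<close>
  each.\<close>

lemma radial_shrink_approximates:
  fixes f :: "'a::real_normed_vector \<Rightarrow> 'b::real_normed_vector"
  assumes X: "subspace X" and f: "f \<in> VC \<omega> X" and "e > 0"
  obtains R s where "R > 0" "0 < s" "s \<le> 1"
    "\<And>x y. x \<in> X \<Longrightarrow> y \<in> X \<Longrightarrow> x \<noteq> y \<Longrightarrow>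
      norm ((f (radial_shrink R s x) - f x) - (f (radial_shrink R s y) - f y)) \<le> 2 * e * \<omega> (3 * norm (x - y))"
proof -
  have fs: "f \<in> VC_small \<omega> X" and fl: "f \<in> VC_large \<omega> X" and ff: "f \<in> VC_far \<omega> X"
    using f by (auto simp: VC_def)
  have fX: "f \<in> holder_space \<omega> X" using fs by (simp add: VC_small_def)
  obtain L where L: "L > 0" "\<And>x y. x \<in> X \<Longrightarrow> y \<in> X \<Longrightarrow> x \<noteq> y \<Longrightarrow> osc_le L f x y"
    by (rule holder_spaceE[OF fX]) blast
  obtain d where d: "d > 0" "\<And>x y. x \<in> X \<Longrightarrow> y \<in> X \<Longrightarrow> x \<noteq> y \<Longrightarrow> norm (x - y) \<le> d \<Longrightarrow> osc_le e f x y"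
    by (rule VC_smallE[OF fs \<open>e > 0\<close>]) blast
  obtain D where D: "D > 0" "\<And>x y. x \<in> X \<Longrightarrow> y \<in> X \<Longrightarrow> norm (x - y) \<ge> D \<Longrightarrow> osc_le e f x y"
    by (rule VC_largeE[OF fl \<open>e > 0\<close>]) blast
  obtain N where N: "N > 0" "\<And>x y. x \<in> X \<Longrightarrow> y \<in> X \<Longrightarrow> x \<noteq> y \<Longrightarrow> norm x > N \<Longrightarrow> norm y > N \<Longrightarrow> osc_le e f x y"
    by (rule VC_farE[OF ff \<open>e > 0\<close>]) blast
  have "\<forall>\<^sub>F t in at_top. \<omega> t \<ge> L * \<omega> D / e" using \<omega>_at_top by (simp add: filterlim_at_top)
  then obtain T0 where T0: "\<And>t. t \<ge> T0 \<Longrightarrow> \<omega> t \<ge> L * \<omega> D / e" by (auto simp: eventually_at_top_linorder)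
  \<comment> \<open>At distances of at least \<open>T\<close>, images closer than \<open>D\<close>
    are covered by the crude bound L * \<omega>(D), which \<omega> has outgrown by then.\<close>
  define T where "T = max T0 D"
  have T: "T \<ge> D" "T > 0" using D(1) by (auto simp: T_def)
  have \<omega>T: "L * \<omega> D \<le> e * \<omega> t" if "t \<ge> T" for t
    using T0[of t] that \<open>e > 0\<close> by (simp add: T_def pos_divide_le_eq mult.commute)
  \<comment> \<open>\<open>s\<close> and \<open>R\<close> make the two terms of
    \<open>radial_shrink_contraction\<close> at most d / 2 each. Moreover R \<ge> N + T ensures that
    a pair at distance below \<open>T\<close> with one point beyond \<open>R\<close> lies entirely
    beyond \<open>N\<close>.\<close>
  define s where "s = min 1 (d / (2 * T))"
  define R where "R = N + T + 4 * N * T / d"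
  have s: "0 < s" "s \<le> 1" "s * T \<le> d / 2"
  proof -
    show "0 < s" "s \<le> 1" using d T by (auto simp: s_def)
    have "s * T \<le> d / (2 * T) * T" using T by (intro mult_right_mono) (auto simp: s_def)
    then show "s * T \<le> d / 2" using T by simp
  qed
  have R: "R > 0" "R \<ge> N + T" "2 * (N / R) * T \<le> d / 2"
  proof -
    have pos: "4 * N * T / d > 0" using N d T by simp
    then show "R > 0" "R \<ge> N + T" using N T by (auto simp: R_def)
    have "4 * N * T / d \<le> R" using N T by (simp add: R_def)
    then have "4 * N * T \<le> d * R" using d by (simp add: pos_divide_le_eq mult.commute)
    then show "2 * (N / R) * T \<le> d / 2" using \<open>R > 0\<close> by (simp add: field_simps)
  qed
  let ?r = "radial_shrink R s"
  have rX: "?r x \<in> X" if "x \<in> X" for x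
    using subspace_scale[OF X that] by (simp add: radial_shrink_def)
  have lip: "norm (?r x - ?r y) \<le> 3 * norm (x - y)" for x y
    by (rule radial_shrink_lipschitz) (use s in auto)
  have contr: "norm (?r x - ?r y) \<le> d"
    if "norm x > N" "norm (?r x) \<le> N" "norm (x - y) \<le> T" for x y
    using radial_shrink_contraction[OF s(1,2) less_imp_le[OF N(1)] that(1,2) R(2,1) that(3)] s(3) R(3) by linarith
  show thesis
  proof (rule that[OF R(1) s(1,2)])
    fix x y assume xy: "x \<in> X" "y \<in> X" "x \<noteq> y"
    define t where "t = norm (x - y)"
    have t: "t > 0" "3 * t > 0" using xy(3) by (auto simp: t_def)
    have e\<omega>: "e * \<omega> t \<le> e * \<omega> (3 * t)" using t \<open>e > 0\<close> by (intro mult_left_mono \<omega>_mono) auto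
    have direct: "norm (f x - f y) \<le> e * \<omega> (3 * t)" if "osc_le e f x y"
      using that e\<omega> by (simp add: t_def)
    have shrunk: "norm (f (?r x) - f (?r y)) \<le> e * \<omega> (3 * t)" if "?r x \<noteq> ?r y \<Longrightarrow> osc_le e f (?r x) (?r y)"
      by (rule osc_le_mono[of "?r x" "?r y", OF that]) (use lip \<open>e > 0\<close> t in \<open>auto simp: t_def\<close>)
    \<comment> \<open>Inside the ball of radius \<open>R\<close> the error vanishes identically;
      otherwise each of the two oscillations is estimated on its own.\<close>
    have "f (?r x) - f x = f (?r y) - f y \<or>
      norm (f x - f y) \<le> e * \<omega> (3 * t) \<and> norm (f (?r x) - f (?r y)) \<le> e * \<omega> (3 * t)"
    proof (cases "norm x \<le> R \<and> norm y \<le> R")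
      case True
      then show ?thesis using radial_shrink_eq[of s x R] radial_shrink_eq[of s y R] s by simp
    next
      case far: False
      consider "3 * t \<le> d" | "t \<ge> T" | "t < T" by linarith
      then have "norm (f x - f y) \<le> e * \<omega> (3 * t) \<and> norm (f (?r x) - f (?r y)) \<le> e * \<omega> (3 * t)"
      proof cases
        case 1
        have "t \<le> d" using 1 t by linarith
        then have "osc_le e f x y" using d(2)[OF xy] by (simp add: t_def)
        moreover have "osc_le e f (?r x) (?r y)" if "?r x \<noteq> ?r y"
          by (rule d(2)) (use xy rX that lip[of x y] 1 in \<open>auto simp: t_def\<close>)
        ultimately show ?thesis using direct shrunk by blast
      next
        case 2
        have "osc_le e f x y" by (rule D(2)) (use xy 2 T in \<open>auto simp: t_def\<close>)
        moreover have "norm (f (?r x) - f (?r y)) \<le> e * \<omega> (3 * t)"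
        proof (cases "norm (?r x - ?r y) \<ge> D")
          case True
          then show ?thesis using D(2)[of "?r x" "?r y"] rX xy by (intro shrunk) auto
        next
          case False
          have "norm (f (?r x) - f (?r y)) \<le> L * \<omega> D"
            by (rule osc_le_mono[of "?r x" "?r y"]) (use L(1) L(2)[of "?r x" "?r y"] rX xy False D(1) in auto)
          also have "\<dots> \<le> e * \<omega> (3 * t)" using 2 t by (intro \<omega>T) auto
          finally show ?thesis .
        qed
        ultimately show ?thesis using direct by blast
      next
        case 3
        have N': "norm x > N" "norm y > N"
          using far 3 R(2) norm_triangle_ineq3[of x y] unfolding t_def by linarith+
        have "osc_le e f (?r x) (?r y)" if "?r x \<noteq> ?r y"
        proof (cases "norm (?r x) > N \<and> norm (?r y) > N")
          case True
          then show ?thesis using N(2) rX xy that by blast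
        next
          case False
          \<comment> \<open>One image has entered radius \<open>N\<close> while both points are
            outside, so the contraction brings the pair within reach of the small-scale
            bound.\<close>
          then have "norm (?r x - ?r y) \<le> d"
            using contr[of x y] contr[of y x] N' 3 by (auto simp: t_def norm_minus_commute)
          then show ?thesis using d(2) rX xy that by blast
        qed
        then show ?thesis using direct[OF N(2)[OF xy N']] shrunk by blast
      qed
      then show ?thesis ..
    qed
    moreover have "(f (?r x) - f x) - (f (?r y) - f y) = (f (?r x) - f (?r y)) - (f x - f y)" by simp
    then have "norm ((f (?r x) - f x) - (f (?r y) - f y)) \<le> norm (f (?r x) - f (?r y)) + norm (f x - f y)"
      using norm_triangle_ineq4 by metis
    moreover have "e * \<omega> (3 * t) \<ge> 0" using \<open>e > 0\<close> \<omega>_pos[OF t(2)] by simp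
    ultimately show "norm ((f (?r x) - f x) - (f (?r y) - f y)) \<le> 2 * e * \<omega> (3 * norm (x - y))"
      unfolding t_def by auto
  qed
qed

text \<open>Two doublings bound \<omega>(3t) by C^2 \<omega>(t), which absorbs the Lipschitz
  constant of the radial map.\<close>

lemma VC_bounded_support_approximation:
  fixes f :: "'a::real_normed_vector \<Rightarrow> 'b::real_normed_vector"
  assumes doubling: "\<And>t. t > 0 \<Longrightarrow> \<omega> (2 * t) \<le> C * \<omega> t" and "C > 1"
    and X: "subspace X" and f: "f \<in> VC \<omega> X" and "e > 0"
  obtains h R where "h \<in> VC_small \<omega> X" "R > 0" "\<And>x. x \<in> X \<Longrightarrow> norm x \<ge> R \<Longrightarrow> h x = 0"
    "\<And>x y. x \<in> X \<Longrightarrow> y \<in> X \<Longrightarrow> x \<noteq> y \<Longrightarrow> osc_le e (\<lambda>x. h x - f x) x y"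
proof -
  have C: "C\<^sup>2 > 0" using \<open>C > 1\<close> by simp
  have triple: "\<omega> (3 * t) \<le> C\<^sup>2 * \<omega> t" if "t > 0" for t
  proof -
    have "\<omega> (3 * t) \<le> \<omega> (2 * (2 * t))" using that by (intro \<omega>_mono) auto
    also have "\<dots> \<le> C * \<omega> (2 * t)" using that by (intro doubling) auto
    also have "\<dots> \<le> C * (C * \<omega> t)" using that \<open>C > 1\<close> by (intro mult_left_mono doubling) auto
    finally show ?thesis by (simp add: power2_eq_square)
  qed
  \<comment> \<open>The factor 2 is the number of oscillations added, C^2 the loss in passing from
    scale 3t to t.\<close>
  have "e / (2 * C\<^sup>2) > 0" using \<open>e > 0\<close> C by simp
  then obtain R s where R: "R > 0" and s: "0 < s" "s \<le> 1" and
    close: "\<And>x y. x \<in> X \<Longrightarrow> y \<in> X \<Longrightarrow> x \<noteq> y \<Longrightarrow>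
      norm ((f (radial_shrink R s x) - f x) - (f (radial_shrink R s y) - f y))
        \<le> 2 * (e / (2 * C\<^sup>2)) * \<omega> (3 * norm (x - y))"
    by (rule radial_shrink_approximates[OF X f]) blast
  let ?r = "radial_shrink R s"
  \<comment> \<open>Subtracting \<open>f 0\<close> makes the map vanish where the radial map does
    and leaves all differences unchanged.\<close>
  define h where "h x = f (?r x) - f 0" for x
  have fs: "f \<in> VC_small \<omega> X" using f by (simp add: VC_def)
  have fX: "f \<in> holder_space \<omega> X" using fs by (simp add: VC_small_def)
  have rX: "?r x \<in> X" if "x \<in> X" for x
    using subspace_scale[OF X that] by (simp add: radial_shrink_def)
  have lip: "norm (?r x - ?r y) \<le> 3 * norm (x - y)" for x y
    by (rule radial_shrink_lipschitz) (use s in auto)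
  have osc: "osc_le (a * C\<^sup>2) h x y" if xy: "x \<in> X" "y \<in> X" "x \<noteq> y" "a > 0"
    and a: "?r x \<noteq> ?r y \<Longrightarrow> osc_le a f (?r x) (?r y)" for a x y
  proof -
    have t: "norm (x - y) > 0" using xy by simp
    have "norm (f (?r x) - f (?r y)) \<le> a * \<omega> (3 * norm (x - y))"
      by (rule osc_le_mono[of "?r x" "?r y", OF a]) (use lip that t in auto)
    also have "\<dots> \<le> a * (C\<^sup>2 * \<omega> (norm (x - y)))" using \<open>a > 0\<close> by (intro mult_left_mono triple t) auto
    finally show ?thesis by (simp add: h_def mult.assoc)
  qed
  show thesis
  proof (rule that)
    show "h \<in> VC_small \<omega> X"
      unfolding VC_small_iff
    proof (intro conjI allI impI)
      obtain L where L: "L > 0" "\<And>x y. x \<in> X \<Longrightarrow> y \<in> X \<Longrightarrow> x \<noteq> y \<Longrightarrow> osc_le L f x y"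
        by (rule holder_spaceE[OF fX]) blast
      show "h \<in> holder_space \<omega> X"
        unfolding holder_space_iff
      proof (intro exI[of _ "L * C\<^sup>2"] conjI ballI impI)
        show "L * C\<^sup>2 > 0" using L(1) C by simp
        fix x y assume "x \<in> X" "y \<in> X" "x \<noteq> y"
        then show "osc_le (L * C\<^sup>2) h x y" using L rX by (intro osc) auto
      qed
      fix a :: real assume "a > 0"
      then have "a / C\<^sup>2 > 0" using C by simp
      then obtain d where d: "d > 0"
          "\<And>x y. x \<in> X \<Longrightarrow> y \<in> X \<Longrightarrow> x \<noteq> y \<Longrightarrow> norm (x - y) \<le> d \<Longrightarrow> osc_le (a / C\<^sup>2) f x y"
        by (rule VC_smallE[OF fs]) blast
      show "\<exists>d>0. \<forall>x\<in>X. \<forall>y\<in>X. x \<noteq> y \<longrightarrow> norm (x - y) \<le> d \<longrightarrow> osc_le a h x y"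
      \<comment> \<open>The radial map at most triples distances.\<close>
      proof (intro exI[of _ "d / 3"] conjI ballI impI)
        fix x y assume xy: "x \<in> X" "y \<in> X" "x \<noteq> y" "norm (x - y) \<le> d / 3"
        have "osc_le (a / C\<^sup>2 * C\<^sup>2) h x y"
        proof (rule osc[OF xy(1-3) \<open>a / C\<^sup>2 > 0\<close>])
          assume "?r x \<noteq> ?r y"
          then show "osc_le (a / C\<^sup>2) f (?r x) (?r y)" using lip[of x y] xy(4) by (intro d(2) rX xy) auto
        qed
        then show "osc_le a h x y" using C by simp
      qed (use d in simp)
    qed
    \<comment> \<open>This is the radius at which the descending branch of the profile reaches
      0.\<close>
    show "(1 + s) * R / s > 0" using R s by simp
    show "h x = 0" if "norm x \<ge> (1 + s) * R / s" for x
    proof -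
      have "s * norm x \<ge> (1 + s) * R" using that s by (simp add: pos_divide_le_eq mult.commute)
      then have "shrink_radius R s (norm x) = 0" by (simp add: shrink_radius_def)
      then show ?thesis by (simp add: h_def radial_shrink_def)
    qed
    show "osc_le e (\<lambda>x. h x - f x) x y" if xy: "x \<in> X" "y \<in> X" "x \<noteq> y" for x y
    proof -
      have "norm ((h x - f x) - (h y - f y)) \<le> e / C\<^sup>2 * \<omega> (3 * norm (x - y))"
        using close[OF xy] by (simp add: h_def)
      also have "\<dots> \<le> e / C\<^sup>2 * (C\<^sup>2 * \<omega> (norm (x - y)))"
        using xy(3) \<open>e > 0\<close> C by (intro mult_left_mono triple) auto
      finally show ?thesis using C by simp
    qed
  qed
qed

text \<open>The support is cut off before smoothing, since the radial map has corners in its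
  profile. Smoothing enlarges the support by at most 1, and for the smoothed map the conditions at
  large scales and far out follow from bounded support.\<close>

lemma holder_closure_C_inf_bs_VC:
  assumes doubling: "\<And>t. t > 0 \<Longrightarrow> \<omega> (2 * t) \<le> C * \<omega> t" and "C > 1"
  shows "holder_closure \<omega> (c0 A) (C_inf_bs (c0 A) \<inter> VC \<omega> (c0 A))
    = (VC \<omega> (c0 A) :: ('i czero \<Rightarrow> 'b::banach) set)"
proof
  let ?X = "c0 A :: 'i czero set"
  show "VC \<omega> ?X \<subseteq> holder_closure \<omega> ?X (C_inf_bs ?X \<inter> (VC \<omega> ?X :: ('i czero \<Rightarrow> 'b) set))"
  proof
    fix f :: "'i czero \<Rightarrow> 'b" assume f: "f \<in> VC \<omega> ?X"
    show "f \<in> holder_closure \<omega> ?X (C_inf_bs ?X \<inter> VC \<omega> ?X)"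
      unfolding holder_closure_iff
    proof (intro conjI allI impI)
      show "f \<in> holder_space \<omega> ?X" using f by (simp add: VC_def VC_small_def)
      fix e :: real assume "e > 0"
      then have e: "e / 2 > 0" by simp
      obtain h R where h: "h \<in> VC_small \<omega> ?X" "R > 0" "\<And>x. x \<in> ?X \<Longrightarrow> norm x \<ge> R \<Longrightarrow> h x = 0"
        "\<And>x y. x \<in> ?X \<Longrightarrow> y \<in> ?X \<Longrightarrow> x \<noteq> y \<Longrightarrow> osc_le (e / 2) (\<lambda>x. h x - f x) x y"
        by (rule VC_bounded_support_approximation[OF doubling \<open>C > 1\<close> subspace_c0 f e]) blast+
      show "\<exists>F\<in>C_inf_bs ?X \<inter> VC \<omega> ?X. \<forall>x\<in>?X. \<forall>y\<in>?X. x \<noteq> y \<longrightarrow> osc_le e (\<lambda>x. F x - f x) x y"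
      proof (rule VC_small_smooth_approximation[OF h(1) e zero_less_one])
        fix F assume F: "F \<in> C_inf ?X" "F \<in> VC_small \<omega> ?X"
          "\<And>x y. x \<in> ?X \<Longrightarrow> y \<in> ?X \<Longrightarrow> x \<noteq> y \<Longrightarrow> osc_le (e / 2) (\<lambda>x. F x - h x) x y"
          "\<And>x c. x \<in> ?X \<Longrightarrow> (\<And>u. u \<in> ?X \<Longrightarrow> norm (u - x) \<le> 1 \<Longrightarrow> h u = c) \<Longrightarrow> F x = c"
        \<comment> \<open>The ball of radius 1 around such a point lies where \<open>h\<close>
          vanishes.\<close>
        have supp: "F x = 0" if x: "x \<in> ?X" "norm x \<ge> R + 1" for x
        proof (rule F(4)[OF x(1)], rule h(3))
          fix u assume "norm (u - x) \<le> 1"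
          then show "norm u \<ge> R" using x(2) norm_triangle_ineq3[of u x] by linarith
        qed
        have "F \<in> VC \<omega> ?X"
          by (rule VC_bounded_support[OF F(2) subspace_0[OF subspace_c0], of "R + 1"]) (use h(2) supp in auto)
        moreover have "F \<in> C_inf_bs ?X"
          unfolding C_inf_bs_def using F(1) supp h(2) by (auto intro!: exI[of _ "R + 1"])
        moreover have "osc_le e (\<lambda>x. F x - f x) x y" if xy: "x \<in> ?X" "y \<in> ?X" "x \<noteq> y" for x y
        proof -
          have "norm ((F x - f x) - (F y - f y)) \<le> norm ((F x - h x) - (F y - h y)) + norm ((h x - f x) - (h y - f y))"
            using norm_triangle_ineq[of "(F x - h x) - (F y - h y)" "(h x - f x) - (h y - f y)"] by (simp add: algebra_simps)
          then show ?thesis using F(3)[OF xy] h(4)[OF xy] by simp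
        qed
        ultimately show ?thesis by blast
      qed
    qed
  qed
qed (intro holder_closure_subset_VC, simp)

end

theorem theorem1p5:
  fixes A :: "'i set" and \<omega> :: "real \<Rightarrow> real" and C\<^sub>d\<^sub>b :: real
  assumes "\<And>t. t > 0 \<Longrightarrow> \<omega> t > 0"
    and "mono_on {0<..} \<omega>"
    and "(\<omega> \<longlongrightarrow> 0) (at_right 0)"
    and "filterlim \<omega> at_top at_top"
    and "((\<lambda>t. t / \<omega> t) \<longlongrightarrow> 0) (at_right 0)"
    and "C\<^sub>d\<^sub>b > 1"
    and "\<And>t. t > 0 \<Longrightarrow> \<omega> (2 * t) \<le> C\<^sub>d\<^sub>b * \<omega> t"
  shows "holder_closure \<omega> (c0 A) (C_inf (c0 A) \<inter> VC_small \<omega> (c0 A))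
           = (VC_small \<omega> (c0 A) :: ('i czero \<Rightarrow> 'y::banach) set)
       \<and> holder_closure \<omega> (c0 A) (C_inf_bs (c0 A) \<inter> VC \<omega> (c0 A))
           = (VC \<omega> (c0 A) :: ('i czero \<Rightarrow> 'y::banach) set)"
  proof -
  interpret modulus \<omega>
    by standard (use assms(1-4) in \<open>auto simp: mono_on_def\<close>)
  show ?thesis
    using holder_closure_C_inf_VC_small holder_closure_C_inf_bs_VC[OF assms(7,6)] by blast
qed

end
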